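(* Let $n\ge 5$ be an integer and let $m\in\{n,n+1\}$. Every $n\times m$ non-split binary matrix $\mathcal M$ with $|\operatorname{disc}(\mathcal M)|\le n$ contains a zero-sum square.
   Context: A binary matrix is a matrix with entries in $\{-1,1\}$. For a binary matrix $\mathcal M=(a_{i,j})$, its discrepancy $\operatorname{disc}(\mathcal M)$ is the sum of all its entries. A square in an $n\times m$ matrix $\mathcal M=(a_{i,j})$ is a $2\times 2$ sub-matrix of the form $\begin{pmatrix} a_{i,j} & a_{i,j+s}\\ a_{i+s,j} & a_{i+s,j+s}\end{pmatrix}$ for some positive integer $s$ (with $1\le i$, $i+s\le n$, $1\le j$, $j+s\le m$). A zero-sum square is a square whose four entries sum to $0$. An $n\times m$ binary matrix $\mathcal M=(a_{i,j})$ is called $t$-split if, for an integer $t$ with $0\le t<n+m$, one has $a_{i,j}=-1$ if $i+j\le t+1$ and $a_{i,j}=1$ otherwise. A binary matrix $\mathcal M$ is called split if either $\mathcal M$, its negative $-\mathcal M$, its horizontal reflection, or its vertical reflection is $t$-split for some $t$; otherwise it is non-split. *)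

theory Defs
  imports "Jordan_Normal_Form.Matrix"
begin

text \<open>
  Matrices of type \<^typ>\<open>int mat\<close> are indexed from 0, so the entry in row \<open>i\<close> and column \<open>j\<close>
  counted from 1 is \<open>M $$ (i - 1, j - 1)\<close>.
\<close>

definition binary_mat :: "int mat \<Rightarrow> bool" where
  "binary_mat M \<longleftrightarrow> elements_mat M \<subseteq> {-1, 1}"

definition disc :: "int mat \<Rightarrow> int" where
  "disc M = (\<Sum>i<dim_row M. \<Sum>j<dim_col M. M $$ (i, j))"

definition is_square :: "int mat \<Rightarrow> nat \<Rightarrow> nat \<Rightarrow> nat \<Rightarrow> bool" where
  "is_square M i j s \<longleftrightarrow> 0 < s \<and> i + s < dim_row M \<and> j + s < dim_col M"

definition square_sum :: "int mat \<Rightarrow> nat \<Rightarrow> nat \<Rightarrow> nat \<Rightarrow> int" where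
  "square_sum M i j s =
     M $$ (i, j) + M $$ (i, j + s) + M $$ (i + s, j) + M $$ (i + s, j + s)"

definition has_zero_sum_square :: "int mat \<Rightarrow> bool" where
  "has_zero_sum_square M \<longleftrightarrow> (\<exists>i j s. is_square M i j s \<and> square_sum M i j s = 0)"

text \<open>The indices are shifted by one explicitly to match the 1-based condition \<open>i + j \<le> t + 1\<close>.\<close>

definition t_split :: "nat \<Rightarrow> int mat \<Rightarrow> bool" where
  "t_split t M \<longleftrightarrow> t < dim_row M + dim_col M \<and>
     (\<forall>i<dim_row M. \<forall>j<dim_col M.
        M $$ (i, j) = (if (i + 1) + (j + 1) \<le> t + 1 then -1 else 1))"

definition horizontal_reflection :: "int mat \<Rightarrow> int mat" where
  "horizontal_reflection M =
     mat (dim_row M) (dim_col M) (\<lambda>(i, j). M $$ (i, dim_col M - 1 - j))"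

definition vertical_reflection :: "int mat \<Rightarrow> int mat" where
  "vertical_reflection M =
     mat (dim_row M) (dim_col M) (\<lambda>(i, j). M $$ (dim_row M - 1 - i, j))"

text \<open>
  The negatives of the two reflections need not be listed: rotating a \<open>t\<close>-split matrix by a
  half turn and negating it gives a \<open>(dim_row M + dim_col M - 1 - t)\<close>-split matrix.
\<close>

definition split_mat :: "int mat \<Rightarrow> bool" where
  "split_mat M \<longleftrightarrow> (\<exists>t. t_split t M \<or> t_split t (- M) \<or>
     t_split t (horizontal_reflection M) \<or> t_split t (vertical_reflection M))"

end

theory Submission
  imports Defs
begin

text \<open>
A matrix is read as a predicate \<open>P\<close> on integer pairs that tells which entries are \<open>1\<close>, the plus
cells; a square has sum zero iff exactly two of its corners are plus cells. Suppose that no square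
has sum zero.

Call a square of side 1 a window. Every window has a majority sign. If two adjacent windows have
different majorities, then their six cells are forced: they show one step of a diagonal line that
separates the two signs. Squares of side at most 2 continue this line in both directions until it
leaves the matrix, and larger squares then make one whole side of the line monochromatic. Unless the
line runs through the middle, in which case the matrix is split, the line therefore cuts off a
monochromatic triangle at a corner of the matrix (\<open>diagonal_step_small_triangle\<close>).

So majorities change only along the borders of at most four corner triangles. The windows outside
the triangles are connected and hence all have the same majority, without loss of generality minus,
and the triangles consist of plus cells (\<open>sea_exists\<close>): the matrix is a sea of minus cells, in which
no two plus cells touch, together with triangular islands at the corners.

Squares that have two corners on two islands need a third plus cell. Applied to the largest island,
this excludes islands at the adjacent corners and, unless all islands consist of three cells, also at
the opposite corner (\<open>no_vertical_neighbour\<close>, \<open>no_horizontal_neighbour\<close>, \<open>no_opposite_island\<close>). If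
there is a single larger island, then squares with one corner on it keep plus cells of the sea away
from the diagonal of the matrix that starts at the corner of the island (\<open>sea_strip\<close>), and leave for
them only two small triangles at the adjacent corners.

Finally the plus cells are counted: those of the islands exactly, the isolated ones by dividing the
matrix into windows, each of which contains at most one. The result is always fewer than
\<open>(n * m - n) / 2\<close> plus cells, that is, discrepancy less than \<open>- n\<close>, with one exception: if
\<open>m = n\<close> and the island is as large as possible, then no room is left for isolated plus cells, and the
matrix is split again.
\<close>

section \<open>Patterns without zero-sum squares\<close>

definition balanced :: "bool \<Rightarrow> bool \<Rightarrow> bool \<Rightarrow> bool \<Rightarrow> bool" where
  "balanced a b c d \<longleftrightarrow> (a \<noteq> b \<and> c \<noteq> d) \<or> (a = b \<and> c = d \<and> a \<noteq> c)"

text \<open>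
The numbers \<open>n\<close> and \<open>m\<close> of rows and columns are integers, so that reflections and diagonals can be
written with unrestricted subtraction.
\<close>

definition no_zero_square :: "int \<Rightarrow> int \<Rightarrow> (int \<Rightarrow> int \<Rightarrow> bool) \<Rightarrow> bool" where
  "no_zero_square n m P \<longleftrightarrow> (\<forall>i j s. 0 \<le> i \<longrightarrow> 0 \<le> j \<longrightarrow> 0 < s \<longrightarrow> i + s < n \<longrightarrow> j + s < m \<longrightarrow>
     \<not> balanced (P i j) (P i (j + s)) (P (i + s) j) (P (i + s) (j + s)))"

definition flip_cols :: "int \<Rightarrow> (int \<Rightarrow> int \<Rightarrow> bool) \<Rightarrow> int \<Rightarrow> int \<Rightarrow> bool" where
  "flip_cols m P = (\<lambda>i j. P i (m - 1 - j))"

definition flip_rows :: "int \<Rightarrow> (int \<Rightarrow> int \<Rightarrow> bool) \<Rightarrow> int \<Rightarrow> int \<Rightarrow> bool" where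
  "flip_rows n P = (\<lambda>i j. P (n - 1 - i) j)"

definition negated :: "(int \<Rightarrow> int \<Rightarrow> bool) \<Rightarrow> int \<Rightarrow> int \<Rightarrow> bool" where
  "negated P = (\<lambda>i j. \<not> P i j)"

definition transposed :: "(int \<Rightarrow> int \<Rightarrow> bool) \<Rightarrow> int \<Rightarrow> int \<Rightarrow> bool" where
  "transposed P = (\<lambda>i j. P j i)"

lemma no_zero_squareD:
  assumes "no_zero_square n m P" "0 \<le> i" "0 \<le> j" "i < k" "k < n" "l < m" "k - i = l - j"
  shows "\<not> balanced (P i j) (P i l) (P k j) (P k l)"
proof -
  obtain s where k: "k = i + s" and l: "l = j + s" using assms(7) by (metis add.commute diff_add_cancel)
  show ?thesis using assms(1-6) unfolding no_zero_square_def k l by auto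
qed

lemma flip_cols_flip_cols [simp]: "flip_cols m (flip_cols m P) = P" by (simp add: flip_cols_def)
lemma flip_rows_flip_rows [simp]: "flip_rows n (flip_rows n P) = P" by (simp add: flip_rows_def)
lemma transposed_transposed [simp]: "transposed (transposed P) = P" by (simp add: transposed_def)
lemma flip_rows_flip_cols [simp]: "flip_rows n (flip_cols m P) = flip_cols m (flip_rows n P)"
  by (simp add: flip_cols_def flip_rows_def)
lemma flip_cols_negated: "flip_cols m (negated P) = negated (flip_cols m P)"
  by (simp add: flip_cols_def negated_def)
lemma flip_rows_negated: "flip_rows n (negated P) = negated (flip_rows n P)"
  by (simp add: flip_rows_def negated_def)
lemma transposed_flip_cols: "transposed (flip_cols m P) = flip_rows m (transposed P)"
  by (simp add: flip_cols_def flip_rows_def transposed_def)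

lemma no_zero_square_negated [simp]: "no_zero_square n m (negated P) = no_zero_square n m P"
  unfolding no_zero_square_def negated_def balanced_def by simp

lemma no_zero_square_transposed: "no_zero_square n m P \<Longrightarrow> no_zero_square m n (transposed P)"
  unfolding no_zero_square_def transposed_def balanced_def by blast

lemma no_zero_square_flip_cols: assumes "no_zero_square n m P" shows "no_zero_square n m (flip_cols m P)"
  unfolding no_zero_square_def
proof (intro allI impI)
  fix i j s :: int assume a: "0 \<le> i" "0 \<le> j" "0 < s" "i + s < n" "j + s < m"
  have "\<not> balanced (P i (m - 1 - (j + s))) (P i (m - 1 - j))
    (P (i + s) (m - 1 - (j + s))) (P (i + s) (m - 1 - j))"
    using a by (intro no_zero_squareD[OF assms]) auto
  then show "\<not> balanced (flip_cols m P i j) (flip_cols m P i (j + s)) (flip_cols m P (i + s) j)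
    (flip_cols m P (i + s) (j + s))"
    unfolding flip_cols_def balanced_def by auto
qed

lemma no_zero_square_flip_rows: assumes "no_zero_square n m P" shows "no_zero_square n m (flip_rows n P)"
proof -
  have "no_zero_square m n (flip_cols n (transposed P))" using assms
    by (intro no_zero_square_flip_cols no_zero_square_transposed)
  then have "no_zero_square n m (transposed (flip_cols n (transposed P)))"
    by (rule no_zero_square_transposed)
  then show ?thesis by (simp add: transposed_flip_cols)
qed

definition few_pluses :: "(int \<Rightarrow> int \<Rightarrow> bool) \<Rightarrow> int \<Rightarrow> int \<Rightarrow> bool" where
  "few_pluses P i j \<longleftrightarrow> (\<forall>x y x' y'. x \<in> {i, i + 1} \<longrightarrow> y \<in> {j, j + 1} \<longrightarrow> x' \<in> {i, i + 1} \<longrightarrow> y' \<in> {j, j + 1} \<longrightarrow>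
     P x y \<longrightarrow> P x' y' \<longrightarrow> x = x' \<and> y = y')"

lemma few_pluses_iff: "few_pluses P i j \<longleftrightarrow> \<not> (P i j \<and> P i (j + 1)) \<and> \<not> (P i j \<and> P (i + 1) j) \<and>
   \<not> (P i j \<and> P (i + 1) (j + 1)) \<and> \<not> (P i (j + 1) \<and> P (i + 1) j) \<and>
   \<not> (P i (j + 1) \<and> P (i + 1) (j + 1)) \<and> \<not> (P (i + 1) j \<and> P (i + 1) (j + 1))"
  unfolding few_pluses_def by auto

text \<open>
Without zero-sum squares a window cannot contain two plus cells and two minus cells, so it has a
majority: \<open>few_pluses P i j\<close> says that it is minus.
\<close>

lemma few_pluses_negated:
  assumes "no_zero_square n m P" "0 \<le> i" "0 \<le> j" "i + 1 < n" "j + 1 < m"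
  shows "few_pluses (negated P) i j \<longleftrightarrow> \<not> few_pluses P i j"
proof -
  have "\<not> balanced (P i j) (P i (j + 1)) (P (i + 1) j) (P (i + 1) (j + 1))"
    using assms by (intro no_zero_squareD) auto
  then show ?thesis unfolding few_pluses_iff negated_def balanced_def by blast
qed

lemma few_pluses_flip_cols: "few_pluses (flip_cols m P) i j \<longleftrightarrow> few_pluses P i (m - 2 - j)"
proof -
  have e: "m - 1 - j = m - 2 - j + 1" "m - 1 - (j + 1) = m - 2 - j" by auto
  show ?thesis unfolding few_pluses_iff flip_cols_def e by blast
qed

lemma few_pluses_flip_rows: "few_pluses (flip_rows n P) i j \<longleftrightarrow> few_pluses P (n - 2 - i) j"
proof -
  have e: "n - 1 - i = n - 2 - i + 1" "n - 1 - (i + 1) = n - 2 - i" by auto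
  show ?thesis unfolding few_pluses_iff flip_rows_def e by blast
qed

lemma few_pluses_transposed: "few_pluses (transposed P) i j \<longleftrightarrow> few_pluses P j i"
  unfolding few_pluses_iff transposed_def by blast

text \<open>
The two rows \<open>c c -c\<close> and \<open>c -c -c\<close>: two adjacent windows of different majority, separated by the
diagonal of \<open>c\<close>-cells that runs from the middle of the upper row to the left of the lower row.
\<close>

definition diagonal_step :: "(int \<Rightarrow> int \<Rightarrow> bool) \<Rightarrow> bool \<Rightarrow> int \<Rightarrow> int \<Rightarrow> bool" where
  "diagonal_step P c i j \<longleftrightarrow> P i j = c \<and> P i (j + 1) = c \<and> P (i + 1) j = c \<and>
     P i (j + 2) = (\<not> c) \<and> P (i + 1) (j + 1) = (\<not> c) \<and> P (i + 1) (j + 2) = (\<not> c)"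

text \<open>
A window or square whose upper corners differ has equal lower corners; this applies to the window below
on the left and to the square of side 2. So the next row is constant, and the window below on the right
excludes the colour \<open>c\<close>.
\<close>

lemma diagonal_step_below:
  assumes f: "no_zero_square n m P" and "diagonal_step P c i j" "0 \<le> i" "0 \<le> j" "j + 2 < m" "i + 2 < n"
  shows "P (i + 2) j = (\<not> c) \<and> P (i + 2) (j + 1) = (\<not> c) \<and> P (i + 2) (j + 2) = (\<not> c)"
proof -
  have "\<not> balanced (P (i+1) j) (P (i+1) (j+1)) (P (i+2) j) (P (i+2) (j+1))"
    using assms by (intro no_zero_squareD[OF f]) auto
  moreover have "\<not> balanced (P (i+1) (j+1)) (P (i+1) (j+2)) (P (i+2) (j+1)) (P (i+2) (j+2))"
    using assms by (intro no_zero_squareD[OF f]) auto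
  moreover have "\<not> balanced (P i j) (P i (j+2)) (P (i+2) j) (P (i+2) (j+2))"
    using assms by (intro no_zero_squareD[OF f]) auto
  ultimately show ?thesis using assms(2) unfolding diagonal_step_def balanced_def by metis
qed

text \<open>
The line continues down to the left. By transposing the argument of \<open>diagonal_step_below\<close>, the three
rows now known determine the column on the left.
\<close>

lemma diagonal_step_left:
  assumes f: "no_zero_square n m P" and p: "diagonal_step P c i j"
    and "0 \<le> i" "1 \<le> j" "j + 2 < m" "i + 2 < n"
  shows "diagonal_step P c (i + 1) (j - 1)"
proof -
  note b = diagonal_step_below[OF f p]
  have "\<not> balanced (P i (j-1)) (P i j) (P (i+1) (j-1)) (P (i+1) j)"
    using assms by (intro no_zero_squareD[OF f]) auto
  moreover have "\<not> balanced (P (i+1) (j-1)) (P (i+1) j) (P (i+2) (j-1)) (P (i+2) j)"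
    using assms by (intro no_zero_squareD[OF f]) auto
  moreover have "\<not> balanced (P i (j-1)) (P i (j+1)) (P (i+2) (j-1)) (P (i+2) (j+1))"
    using assms by (intro no_zero_squareD[OF f]) auto
  moreover have e: "i + 1 + 1 = i + 2" "j - 1 + 1 = j" "j - 1 + 2 = j + 1" by auto
  ultimately show ?thesis using p b assms unfolding diagonal_step_def balanced_def e
    by (metis zero_less_one_class.zero_le_one order_trans)
qed

text \<open>
A half turn of the matrix exchanges the two sides of the line; so it reduces statements about the
upper right end of a line to statements about its lower left end.
\<close>

lemma diagonal_step_half_turn:
  "diagonal_step (flip_cols m (flip_rows n P)) (\<not> c) (n - 2 - i) (m - 3 - j) \<longleftrightarrow> diagonal_step P c i j"
proof -
  have e: "n - 1 - (n - 2 - i) = i + 1" "n - 1 - (n - 2 - i + 1) = i"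
    "m - 1 - (m - 3 - j) = j + 2" "m - 1 - (m - 3 - j + 1) = j + 1" "m - 1 - (m - 3 - j + 2) = j" by auto
  show ?thesis unfolding diagonal_step_def flip_cols_def flip_rows_def e by auto
qed

lemma diagonal_step_right:
  assumes f: "no_zero_square n m P" and p: "diagonal_step P c i j"
    and "1 \<le> i" "0 \<le> j" "j + 3 < m" "i + 1 < n"
  shows "diagonal_step P c (i - 1) (j + 1)"
proof -
  have "no_zero_square n m (flip_cols m (flip_rows n P))" using f
    by (intro no_zero_square_flip_cols no_zero_square_flip_rows)
  then have "diagonal_step (flip_cols m (flip_rows n P)) (\<not> c) (n - 2 - i + 1) (m - 3 - j - 1)"
    using p assms by (intro diagonal_step_left) (auto simp: diagonal_step_half_turn)
  then have "diagonal_step (flip_cols m (flip_rows n P)) (\<not> c) (n - 2 - (i - 1)) (m - 3 - (j + 1))"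
    by (simp add: algebra_simps)
  then show ?thesis by (simp only: diagonal_step_half_turn)
qed

text \<open>
The third clause leaves out the two ends of the second diagonal beyond the triangle, in the first row
and column: the steps of the line determine only the cells between them.
\<close>

definition corner_triangle :: "int \<Rightarrow> int \<Rightarrow> (int \<Rightarrow> int \<Rightarrow> bool) \<Rightarrow> int \<Rightarrow> bool \<Rightarrow> bool" where
  "corner_triangle n m P t c \<longleftrightarrow> (\<forall>i j. 0 \<le> i \<longrightarrow> 0 \<le> j \<longrightarrow> i < n \<longrightarrow> j < m \<longrightarrow>
     (i + j \<le> t \<longrightarrow> P i j = c) \<and> (i + j = t + 1 \<longrightarrow> P i j = (\<not> c)) \<and>
     (i + j = t + 2 \<longrightarrow> 1 \<le> i \<longrightarrow> 1 \<le> j \<longrightarrow> P i j = (\<not> c)))"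

lemma diagonal_step_line:
  assumes f: "no_zero_square n m P" and p: "diagonal_step P c i j" and i: "0 \<le> i" "0 \<le> j"
    and t: "t = i + j + 1" "t < n" "t + 1 < m" and x: "0 \<le> x" "x < t"
  shows "diagonal_step P c x (t - 1 - x)"
proof (cases "i \<le> x")
  case True
  then show ?thesis using x(2)
  proof (induction x rule: int_ge_induct)
    case base then show ?case using p t by simp
  next
    case (step x)
    have "diagonal_step P c (x + 1) (t - 1 - x - 1)"
      using step i t by (intro diagonal_step_left[OF f]) auto
    then show ?case by (simp add: algebra_simps)
  qed
next
  case False
  then have "x \<le> i" by simp
  then show ?thesis using x(1)
  proof (induction x rule: int_le_induct)
    case base then show ?case using p t by simp
  next
    case (step x)
    have "diagonal_step P c (x - 1) (t - 1 - x + 1)"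
      using step i t by (intro diagonal_step_right[OF f]) auto
    then show ?case by (simp add: algebra_simps)
  qed
qed

text \<open>
Once the line reaches the border on both sides, the triangle behind it is filled diagonal by
diagonal, away from the line. A cell is the corner of a square whose two neighbouring corners lie
nearer to the line, on the same side, and whose opposite corner lies just beyond it.
\<close>

lemma diagonal_step_corner_triangle:
  assumes f: "no_zero_square n m P" and p: "diagonal_step P c i j" and i: "0 \<le> i" "0 \<le> j"
    and t: "t = i + j + 1" "t < n" "t + 1 < m"
  shows "corner_triangle n m P t c"
proof -
  note L = diagonal_step_line[OF f p i t]
  have t1: "1 \<le> t" using i t by simp
  have B: "t + 1 < n \<Longrightarrow> P (t + 1) 0 = (\<not> c) \<and> P (t + 1) 1 = (\<not> c)"
    using diagonal_step_below[OF f L[of "t - 1"]] t t1 by (simp add: algebra_simps)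
  have d1: "P x y = (\<not> c)" if "0 \<le> x" "0 \<le> y" "x + y = t + 1" "x < n" for x y
  proof -
    have "x = t + 1 \<or> x = t \<or> x < t" using that by linarith
    then consider "x = t + 1" | "x = t" | "x < t" by blast
    then show ?thesis
    proof cases
      case 1 then show ?thesis using B that by auto
    next
      case 2 then show ?thesis using L[of "t - 1"] that t1
        by (auto simp: diagonal_step_def algebra_simps)
    next
      case 3
      have y: "y = t - 1 - x + 2" using that by simp
      show ?thesis using L[of x] that 3 unfolding y by (simp add: diagonal_step_def)
    qed
  qed
  have d2: "P x y = (\<not> c)" if "1 \<le> x" "1 \<le> y" "x + y = t + 2" "x < n" for x y
  proof (cases "x = t + 1")
    case True then show ?thesis using B that by auto
  next
    case False
    have y: "y = t - 1 - (x - 1) + 2" using that by auto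
    show ?thesis using L[of "x - 1"] that False unfolding y by (simp add: diagonal_step_def)
  qed
  have d0: "P x y = c" if "0 \<le> x" "0 \<le> y" "x + y = t \<or> x + y = t - 1" for x y
  proof (cases "x = t")
    case True
    then show ?thesis using L[of "t - 1"] that t1 by (auto simp: diagonal_step_def)
  next
    case False
    then have "y = t - 1 - x \<or> y = t - 1 - x + 1" "x < t" using that t1 by auto
    then show ?thesis using L[of x] that False by (auto simp: diagonal_step_def)
  qed
  have S: "P x y = c" if "0 \<le> x" "0 \<le> y" "x + y = t - int k" for x y k
    using that
  proof (induction k arbitrary: x y rule: less_induct)
    case (less k)
    show ?case
    proof (cases "k \<le> 1")
      case True then show ?thesis using d0[of x y] less.prems by (cases "k = 0") auto
    next
      case False
      \<comment> \<open>this side puts the opposite corner on the first or second diagonal beyond the line\<close>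
      define s where "s = (int k + 2) div 2"
      have s: "2 \<le> s" "s \<le> int k" "2 * s = int k + 1 \<or> 2 * s = int k + 2"
        using False unfolding s_def by auto
      have "P (x + s) y = c" using less.IH[of "nat (int k - s)" "x + s" y] less.prems s by auto
      moreover have "P x (y + s) = c" using less.IH[of "nat (int k - s)" x "y + s"] less.prems s by auto
      moreover have "P (x + s) (y + s) = (\<not> c)"
        using s d1[of "x + s" "y + s"] d2[of "x + s" "y + s"] less.prems t by auto
      moreover have "\<not> balanced (P x y) (P x (y + s)) (P (x + s) y) (P (x + s) (y + s))"
        using less.prems s t by (intro no_zero_squareD[OF f]) auto
      ultimately show ?thesis unfolding balanced_def by auto
    qed
  qed
  show ?thesis unfolding corner_triangle_def
  proof (intro allI impI conjI)
    fix x y :: int assume a: "0 \<le> x" "0 \<le> y" "x < n" "y < m"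
    show "P x y = c" if "x + y \<le> t" using S[of x y "nat (t - x - y)"] a that by auto
    show "P x y = (\<not> c)" if "x + y = t + 1" using d1 a that by auto
    show "P x y = (\<not> c)" if "x + y = t + 2" "1 \<le> x" "1 \<le> y" using d2 a that by auto
  qed
qed

section \<open>Monochromatic corner triangles\<close>

text \<open>
The bound on \<open>t\<close> says that the line lies strictly before the middle of the matrix, so that the triangle
is the smaller side of the line.
\<close>

definition small_triangle :: "int \<Rightarrow> int \<Rightarrow> (int \<Rightarrow> int \<Rightarrow> bool) \<Rightarrow> int \<Rightarrow> bool \<Rightarrow> bool" where
  "small_triangle n m P t c \<longleftrightarrow> 1 \<le> t \<and> 2 * t \<le> n + m - 4 \<and> corner_triangle n m P t c"

text \<open>
The integer \<open>t\<close> may be arbitrarily small or large, so that the constant patterns are included.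
\<close>

definition diagonal_split :: "int \<Rightarrow> int \<Rightarrow> (int \<Rightarrow> int \<Rightarrow> bool) \<Rightarrow> bool" where
  "diagonal_split n m P \<longleftrightarrow> (\<exists>t c. \<forall>i j. 0 \<le> i \<longrightarrow> i < n \<longrightarrow> 0 \<le> j \<longrightarrow> j < m \<longrightarrow> P i j = ((i + j \<le> t) = c))"

text \<open>
The triangle is found on the smaller side of the line; if this is the far side, the half turn brings
it to the first corner. A line in the middle bounds two triangles that fill the matrix.
\<close>

lemma diagonal_step_small_triangle:
  assumes f: "no_zero_square n m P" and nm: "n \<le> m" "m \<le> n + 1"
    and p: "diagonal_step P c i j" and i: "0 \<le> i" "i + 1 < n" "0 \<le> j" "j + 2 < m"
      and ns: "\<not> diagonal_split n m P"
  shows "small_triangle n m P (i + j + 1) c \<or>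
    small_triangle n m (flip_cols m (flip_rows n P)) (n - 2 - i + (m - 2 - j)) (\<not> c)"
proof -
  let ?H = "flip_cols m (flip_rows n P)"
  have f': "no_zero_square n m ?H" using f by (intro no_zero_square_flip_cols no_zero_square_flip_rows)
  have p': "diagonal_step ?H (\<not> c) (n - 2 - i) (m - 3 - j)" using p
    by (simp add: diagonal_step_half_turn)
  have s: "corner_triangle n m P (i + j + 1) c" if "2 * (i + j + 1) \<le> n + m - 3"
    using that nm i by (intro diagonal_step_corner_triangle[OF f p]) auto
  have s': "corner_triangle n m ?H (n - 2 - i + (m - 2 - j)) (\<not> c)" if "2 * (i + j + 1) \<ge> n + m - 3"
    using that nm i by (intro diagonal_step_corner_triangle[OF f' p']) auto
  consider "2 * (i + j + 1) \<le> n + m - 4" | "2 * (i + j + 1) = n + m - 3" | "2 * (i + j + 1) \<ge> n + m - 2"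
    by linarith
  then show ?thesis
  proof cases
    case 1 then show ?thesis using s i unfolding small_triangle_def by simp
  next
    case 3 then show ?thesis using s' i unfolding small_triangle_def by simp
  next
    case 2
    have "P x y = ((x + y \<le> i + j + 1) = c)" if a: "0 \<le> x" "x < n" "0 \<le> y" "y < m" for x y
    proof (cases "x + y \<le> i + j + 1")
      case True then show ?thesis using s 2 a unfolding corner_triangle_def by auto
    next
      case False
      then have "?H (n - 1 - x) (m - 1 - y) = (\<not> c)" using s' 2 a unfolding corner_triangle_def by auto
      then show ?thesis using False by (simp add: flip_cols_def flip_rows_def)
    qed
    then have "diagonal_split n m P" unfolding diagonal_split_def by blast
    then show ?thesis using ns by simp
  qed
qed

lemma diagonal_step_above:
  assumes f: "no_zero_square n m P" and p: "diagonal_step P c i j"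
    and "1 \<le> i" "0 \<le> j" "j + 2 < m" "i + 1 < n"
  shows "P (i - 1) j = c \<and> P (i - 1) (j + 1) = c \<and> P (i - 1) (j + 2) = c"
proof -
  let ?H = "flip_cols m (flip_rows n P)"
  have f': "no_zero_square n m ?H" using f by (intro no_zero_square_flip_cols no_zero_square_flip_rows)
  have "?H (n - 2 - i + 2) (m - 3 - j) = (\<not> \<not> c) \<and> ?H (n - 2 - i + 2) (m - 3 - j + 1) = (\<not> \<not> c)
     \<and> ?H (n - 2 - i + 2) (m - 3 - j + 2) = (\<not> \<not> c)"
    using assms by (intro diagonal_step_below[OF f']) (auto simp: diagonal_step_half_turn)
  moreover have "n - 1 - (n - 2 - i + 2) = i - 1" "m - 1 - (m - 3 - j) = j + 2"
    "m - 1 - (m - 3 - j + 1) = j + 1" "m - 1 - (m - 3 - j + 2) = j" by auto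
  ultimately show ?thesis unfolding flip_cols_def flip_rows_def by (metis (full_types))
qed

text \<open>
A change of majority between two vertically adjacent windows. It yields a horizontal step of the
same line next to it: one in the same rows if there is a further column on the right, otherwise one
in the lower two rows, shifted to the left.
\<close>

lemma vertical_step_small_triangle:
  assumes f: "no_zero_square n m P" and nm: "n \<le> m" "m \<le> n + 1" "3 \<le> m"
    and p: "diagonal_step (transposed P) c j i" and i: "0 \<le> i" "i + 2 < n" "0 \<le> j" "j + 1 < m"
      and ns: "\<not> diagonal_split n m P"
  shows "small_triangle n m P (i + j + 1) c \<or>
    small_triangle n m (flip_cols m (flip_rows n P)) (n - 2 - i + (m - 2 - j)) (\<not> c)"
proof (cases "j + 2 < m")
  case True
  have "transposed P (j + 2) i = (\<not> c) \<and> transposed P (j + 2) (i + 1) = (\<not> c) \<and>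
    transposed P (j + 2) (i + 2) = (\<not> c)"
    using i True by (intro diagonal_step_below[OF no_zero_square_transposed[OF f] p]) auto
  then have "diagonal_step P c i j" using p unfolding diagonal_step_def transposed_def by auto
  then show ?thesis using i True by (intro diagonal_step_small_triangle[OF f nm(1,2) _ _ _ _ _ ns]) auto
next
  case False
  have "small_triangle n m P (i + 1 + (j - 1) + 1) c \<or>
    small_triangle n m (flip_cols m (flip_rows n P)) (n - 2 - (i + 1) + (m - 2 - (j - 1))) (\<not> c)"
  proof (intro diagonal_step_small_triangle[OF f nm(1,2) _ _ _ _ _ ns])
    have "transposed P (j - 1) i = c \<and> transposed P (j - 1) (i + 1) = c \<and>
      transposed P (j - 1) (i + 2) = c"
      using i False nm by (intro diagonal_step_above[OF no_zero_square_transposed[OF f] p]) auto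
    moreover have e: "i + 1 + 1 = i + 2" "j - 1 + 1 = j" "j - 1 + 2 = j + 1" by auto
    ultimately show "diagonal_step P c (i + 1) (j - 1)" using p
      unfolding diagonal_step_def transposed_def e by blast
  qed (use i False nm in auto)
  then show ?thesis by (simp add: algebra_simps)
qed

text \<open>
The common column of the two windows must be mixed, since a constant one would give both windows
the same majority; then the outer columns are constant, and the two possibilities for the common
column are the two directions of the line.
\<close>

lemma few_pluses_change:
  assumes f: "no_zero_square n m P" and i: "0 \<le> i" "i + 1 < n" "0 \<le> j" "j + 2 < m"
    and d: "few_pluses P i j \<noteq> few_pluses P i (j + 1)"
  shows "\<exists>c. diagonal_step P c i j \<or> diagonal_step (flip_cols m P) c i (m - 3 - j)"
proof -
  have e: "m - 1 - (m - 3 - j) = j + 2" "m - 1 - (m - 3 - j + 1) = j + 1"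
    "m - 1 - (m - 3 - j + 2) = j" by auto
  have "\<not> balanced (P i j) (P i (j + 1)) (P (i + 1) j) (P (i + 1) (j + 1))"
    using i by (intro no_zero_squareD[OF f]) auto
  moreover have "\<not> balanced (P i (j + 1)) (P i (j + 2)) (P (i + 1) (j + 1)) (P (i + 1) (j + 2))"
    using i by (intro no_zero_squareD[OF f]) auto
  moreover have e2: "j + 1 + 1 = j + 2" by simp
  ultimately show ?thesis using d
    unfolding few_pluses_iff diagonal_step_def balanced_def flip_cols_def e e2
    by (cases "P i j"; cases "P i (j + 1)"; cases "P i (j + 2)"; cases "P (i + 1) j";
      cases "P (i + 1) (j + 1)"; cases "P (i + 1) (j + 2)"; simp?; blast?)
qed

text \<open>
The four alternatives are the four corners. Measured from the corner in question, the two windows lie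
immediately before and behind the border of its triangle.
\<close>

lemma majority_change_horizontal:
  assumes f: "no_zero_square n m P" and nm: "n \<le> m" "m \<le> n + 1"
    and i: "0 \<le> i" "i + 1 < n" "0 \<le> j" "j + 2 < m"
    and d: "few_pluses P i j \<noteq> few_pluses P i (j + 1)"
      and ns: "\<not> diagonal_split n m P" "\<not> diagonal_split n m (flip_cols m P)"
  shows "(\<exists>c. small_triangle n m P (i + j + 1) c) \<or>
    (\<exists>c. small_triangle n m (flip_cols m P) (i + (m - 2 - j)) c) \<or>
    (\<exists>c. small_triangle n m (flip_rows n P) (n - 2 - i + j + 1) c) \<or>
      (\<exists>c. small_triangle n m (flip_cols m (flip_rows n P)) (n - 2 - i + (m - 2 - j)) c)"
proof -
  obtain c where "diagonal_step P c i j \<or> diagonal_step (flip_cols m P) c i (m - 3 - j)"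
    using few_pluses_change[OF f i d] by blast
  then show ?thesis
  proof
    assume "diagonal_step P c i j"
    from diagonal_step_small_triangle[OF f nm this i ns(1)] show ?thesis by blast
  next
    assume "diagonal_step (flip_cols m P) c i (m - 3 - j)"
    from diagonal_step_small_triangle[OF no_zero_square_flip_cols[OF f] nm this _ _ _ _ ns(2)]
    have "small_triangle n m (flip_cols m P) (i + (m - 3 - j) + 1) c \<or>
      small_triangle n m (flip_rows n P) (n - 2 - i + (m - 2 - (m - 3 - j))) (\<not> c)"
      using i by simp
    moreover have "i + (m - 3 - j) + 1 = i + (m - 2 - j)"
      "n - 2 - i + (m - 2 - (m - 3 - j)) = n - 2 - i + j + 1" by auto
    ultimately show ?thesis by metis
  qed
qed

lemma majority_change_vertical:
  assumes f: "no_zero_square n m P" and nm: "n \<le> m" "m \<le> n + 1" "3 \<le> m"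
    and i: "0 \<le> i" "i + 2 < n" "0 \<le> j" "j + 1 < m"
    and d: "few_pluses P i j \<noteq> few_pluses P (i + 1) j"
      and ns: "\<not> diagonal_split n m P" "\<not> diagonal_split n m (flip_cols m P)"
  shows "(\<exists>c. small_triangle n m P (i + j + 1) c) \<or>
    (\<exists>c. small_triangle n m (flip_cols m P) (i + 1 + (m - 2 - j)) c) \<or>
    (\<exists>c. small_triangle n m (flip_rows n P) (n - 2 - i + j) c) \<or>
      (\<exists>c. small_triangle n m (flip_cols m (flip_rows n P)) (n - 2 - i + (m - 2 - j)) c)"
proof -
  have "few_pluses (transposed P) j i \<noteq> few_pluses (transposed P) j (i + 1)" using d
    by (simp add: few_pluses_transposed)
  then obtain c where "diagonal_step (transposed P) c j i \<or>
    diagonal_step (flip_cols n (transposed P)) c j (n - 3 - i)"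
    using few_pluses_change[OF no_zero_square_transposed[OF f], of j i] i by auto
  then show ?thesis
  proof
    assume "diagonal_step (transposed P) c j i"
    from vertical_step_small_triangle[OF f nm this i ns(1)] show ?thesis by blast
  next
    assume "diagonal_step (flip_cols n (transposed P)) c j (n - 3 - i)"
    then have "diagonal_step (transposed (flip_cols m P)) (\<not> c) (m - 2 - j) i"
      using diagonal_step_half_turn[of n m "transposed (flip_cols m P)" "\<not> c" "m - 2 - j" i]
        by (simp add: transposed_flip_cols)
    from vertical_step_small_triangle[OF no_zero_square_flip_cols[OF f] nm this _ _ _ _ ns(2)]
    have "small_triangle n m (flip_cols m P) (i + (m - 2 - j) + 1) (\<not> c) \<or>
      small_triangle n m (flip_rows n P) (n - 2 - i + (m - 2 - (m - 2 - j))) c"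
      using i by simp
    moreover have "i + (m - 2 - j) + 1 = i + 1 + (m - 2 - j)"
      "n - 2 - i + (m - 2 - (m - 2 - j)) = n - 2 - i + j" by auto
    ultimately show ?thesis by metis
  qed
qed

lemma corner_triangle_in: "corner_triangle n m P t c \<Longrightarrow> 0 \<le> i \<Longrightarrow> 0 \<le> j \<Longrightarrow> i < n \<Longrightarrow> j < m \<Longrightarrow> i + j \<le> t \<Longrightarrow>
  P i j = c"
  and corner_triangle_out: "corner_triangle n m P t c \<Longrightarrow> 0 \<le> i \<Longrightarrow> 0 \<le> j \<Longrightarrow> i < n \<Longrightarrow> j < m \<Longrightarrow> i + j = t + 1 \<Longrightarrow>
    P i j = (\<not> c)"
  and corner_triangle_out2: "corner_triangle n m P t c \<Longrightarrow> 1 \<le> i \<Longrightarrow> 1 \<le> j \<Longrightarrow> i < n \<Longrightarrow> j < m \<Longrightarrow>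
    i + j = t + 2 \<Longrightarrow> P i j = (\<not> c)"
  unfolding corner_triangle_def by simp_all

lemma corner_triangle_le:
  assumes "corner_triangle n m P t c" "corner_triangle n m P t' c'" "0 \<le> t" "0 \<le> t'" "t + 1 < m" "0 < n"
  shows "t' \<le> t"
proof (rule ccontr)
  assume n: "\<not> t' \<le> t"
  have "P 0 0 = c" "P 0 (t + 1) = (\<not> c)"
    using assms by (simp_all add: corner_triangle_in[OF assms(1)] corner_triangle_out[OF assms(1)])
  moreover have "P 0 0 = c'" "P 0 (t + 1) = c'"
    using n assms by (simp_all add: corner_triangle_in[OF assms(2)])
  ultimately show False by simp
qed

lemma corner_triangle_unique:
  assumes "corner_triangle n m P t c" "corner_triangle n m P t' c'" "0 \<le> t" "0 \<le> t'" "t + 1 < m"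
    "t' + 1 < m" "0 < n"
  shows "t = t'"
  using corner_triangle_le[OF assms(1,2)] corner_triangle_le[OF assms(2,1)] assms(3-) by simp

text \<open>
Two triangles at the ends of the first column. If they met, then near the point of contact, in the
first two columns, the two descriptions of the cells would contradict each other.
\<close>

lemma corner_triangle_vertical:
  assumes s: "corner_triangle n m P t c" "corner_triangle n m (flip_rows n P) v c'"
    and b: "1 \<le> t" "t \<le> n - 2" "1 \<le> v" "v \<le> n - 2" "2 \<le> m"
  shows "t + v \<le> n - 3"
proof (rule ccontr)
  assume "\<not> t + v \<le> n - 3"
  have t: "P t 0 = c" "P t 1 = (\<not> c)" "P (t - 1) 1 = c"
    using b by (simp_all add: corner_triangle_in[OF s(1)] corner_triangle_out[OF s(1)])
  have V: "P x y = c'" if "x < n" "0 \<le> y" "y < m" "n - 1 - x + y \<le> v" for x y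
    using corner_triangle_in[OF s(2), of "n - 1 - x" y] that b by (simp add: flip_rows_def)
  have V1: "P x y = (\<not> c')" if "x < n" "0 \<le> y" "y < m" "n - 1 - x + y = v + 1" "0 \<le> x" for x y
    using corner_triangle_out[OF s(2), of "n - 1 - x" y] that b by (simp add: flip_rows_def)
  have V2: "P x y = (\<not> c')" if "x < n - 1" "1 \<le> y" "y < m" "n - 1 - x + y = v + 2" "0 \<le> x" for x y
    using corner_triangle_out2[OF s(2), of "n - 1 - x" y] that b by (simp add: flip_rows_def)
  consider "t + v \<ge> n" | "t + v = n - 1" | "t + v = n - 2" using \<open>\<not> t + v \<le> n - 3\<close> by linarith
  then show False
  proof cases
    case 1
    have "P t 0 = c'" "P t 1 = c'" using 1 b by (simp_all add: V)
    then show False using t by simp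
  next
    case 2
    have "P t 0 = c'" "P (t - 1) 1 = (\<not> c')" using 2 b by (simp_all add: V V2)
    then show False using t by simp
  next
    case 3
    have "P t 0 = (\<not> c')" "P t 1 = (\<not> c')" using 3 b by (simp_all add: V1 V2)
    then show False using t by simp
  qed
qed

lemma corner_triangle_transposed: "corner_triangle n m P t c \<Longrightarrow> corner_triangle m n (transposed P) t c"
  unfolding corner_triangle_def transposed_def by (simp add: add.commute)

lemma corner_triangle_horizontal:
  assumes s: "corner_triangle n m P t c" "corner_triangle n m (flip_cols m P) u c'"
    and b: "1 \<le> t" "t \<le> m - 2" "1 \<le> u" "u \<le> m - 2" "2 \<le> n"
  shows "t + u \<le> m - 3"
proof (rule corner_triangle_vertical)
  show "corner_triangle m n (flip_rows m (transposed P)) u c'"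
    using corner_triangle_transposed[OF s(2)] by (simp add: transposed_flip_cols)
qed (use corner_triangle_transposed[OF s(1)] b in auto)

text \<open>
By the bounds on the sizes, the inequality could fail only in a square matrix, for two triangles of
size \<open>n - 2\<close>; but there the second diagonal beyond the first triangle belongs to the second one.
\<close>

lemma corner_triangle_opposite:
  assumes s: "corner_triangle n m P t c" "corner_triangle n m (flip_cols m (flip_rows n P)) w c'"
    and b: "1 \<le> t" "2 * t \<le> n + m - 4" "1 \<le> w" "2 * w \<le> n + m - 4" and nm: "n \<le> m" "m \<le> n + 1"
  shows "t + w \<le> n + m - 5"
proof (rule ccontr)
  assume "\<not> t + w \<le> n + m - 5"
  then have "t + w = n + m - 4" using b by linarith
  moreover have "m = n \<or> m = n + 1" using nm by linarith
  ultimately have e: "t = w" "t = n - 2" "m = n" using b by presburger+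
  have "P 1 (t + 1) = (\<not> c)" "P 1 t = (\<not> c)"
    using e b nm by (simp_all add: corner_triangle_out2[OF s(1)] corner_triangle_out[OF s(1)])
  moreover have "flip_cols m (flip_rows n P) (n - 2) 1 = (\<not> c')"
    by (rule corner_triangle_out[OF s(2)]) (use e b nm in auto)
  moreover have "flip_cols m (flip_rows n P) (n - 2) 0 = c'"
    by (rule corner_triangle_in[OF s(2)]) (use e b nm in auto)
  moreover have "n - 1 - (n - 2) = 1" "m - 1 - 1 = t" "m - 1 - 0 = t + 1" using e by auto
  ultimately show False unfolding flip_cols_def flip_rows_def by (simp add: add.commute)
qed

section \<open>The sea outside the corner triangles\<close>

text \<open>
The windows outside four triangles of sizes \<open>t\<close>, \<open>u\<close>, \<open>v\<close>, \<open>w\<close> at the top left, top right, bottom left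
and bottom right corner; size 0 stands for an absent triangle.
\<close>

definition outside :: "int \<Rightarrow> int \<Rightarrow> int \<Rightarrow> int \<Rightarrow> int \<Rightarrow> int \<Rightarrow> int \<Rightarrow> int \<Rightarrow> bool" where
  "outside n m t u v w i j \<longleftrightarrow> 0 \<le> i \<and> i + 1 < n \<and> 0 \<le> j \<and> j + 1 < m \<and>
     t \<le> i + j \<and> u \<le> i + (m - 2 - j) \<and> v \<le> n - 2 - i + j \<and> w \<le> n - 2 - i + (m - 2 - j)"

text \<open>
In each row the windows outside form an interval, which starts at \<open>L i\<close>, and the intervals of
consecutive rows overlap.
\<close>

lemma outside_connected:
  fixes W :: "int \<Rightarrow> int \<Rightarrow> bool"
  assumes h: "\<And>i j. outside n m t u v w i j \<Longrightarrow> outside n m t u v w i (j + 1) \<Longrightarrow> W i j = W i (j + 1)"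
    and v: "\<And>i j. outside n m t u v w i j \<Longrightarrow> outside n m t u v w (i + 1) j \<Longrightarrow> W i j = W (i + 1) j"
    and b: "t + u \<le> m - 2" "v + w \<le> m - 2" "t + w \<le> n + m - 5" "u + v \<le> n + m - 5"
      "0 \<le> t" "0 \<le> u" "0 \<le> v" "0 \<le> w" "2 \<le> n" "2 \<le> m"
  shows "\<exists>b. \<forall>i j. outside n m t u v w i j \<longrightarrow> W i j = b"
proof -
  \<comment> \<open>the first column outside the two triangles on the left\<close>
  define L where "L i = max 0 (max (t - i) (v - (n - 2 - i)))" for i
  have outL: "outside n m t u v w i (L i)" if "0 \<le> i" "i + 1 < n" for i
    using that b unfolding outside_def L_def by (auto simp: max_def)
  have row: "W i j = W i j'" if o: "outside n m t u v w i j'" "outside n m t u v w i j"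
    and "j' \<le> j" for i j j'
    using \<open>j' \<le> j\<close> o(2)
  proof (induction j rule: int_ge_induct)
    case base show ?case ..
  next
    case (step j)
    have "outside n m t u v w i j" using step.prems step.hyps o(1) unfolding outside_def by auto
    then show ?case using step h by metis
  qed
  have leL: "L i \<le> j" if "outside n m t u v w i j" for i j
    using that unfolding outside_def L_def by auto
  have all: "W i j = W 0 (L 0)" if "0 \<le> i" "outside n m t u v w i j" for i j
    using that
  proof (induction i arbitrary: j rule: int_ge_induct)
    case base then show ?case using row[OF outL] leL b by auto
  next
    case (step i)
    have i: "0 \<le> i" "i + 2 < n" using step unfolding outside_def by auto
    let ?k = "max (L i) (L (i + 1))"
    have o: "outside n m t u v w i ?k" "outside n m t u v w (i + 1) ?k"
      using i b unfolding outside_def L_def by (auto simp: max_def)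
    have "W (i + 1) j = W (i + 1) (L (i + 1))" "W (i + 1) ?k = W (i + 1) (L (i + 1))"
      using row[OF outL] leL step.prems o i by auto
    moreover have "W i ?k = W (i + 1) ?k" using v o by blast
    moreover have "W i ?k = W 0 (L 0)" using step.IH o by blast
    ultimately show ?case by simp
  qed
  then show ?thesis unfolding outside_def by metis
qed

text \<open>
Majority minus everywhere outside the triangles, which are made of plus cells. The sizes are listed as
in \<open>outside\<close>, so that reflections just permute them.
\<close>

definition sea :: "int \<Rightarrow> int \<Rightarrow> (int \<Rightarrow> int \<Rightarrow> bool) \<Rightarrow> int \<Rightarrow> int \<Rightarrow> int \<Rightarrow> int \<Rightarrow> bool" where
  "sea n m P t u v w \<longleftrightarrow> no_zero_square n m P \<and> (t = 0 \<or> small_triangle n m P t True) \<and>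
     (u = 0 \<or> small_triangle n m (flip_cols m P) u True) \<and>
     (v = 0 \<or> small_triangle n m (flip_rows n P) v True) \<and>
     (w = 0 \<or> small_triangle n m (flip_cols m (flip_rows n P)) w True) \<and>
     (\<forall>i j. outside n m t u v w i j \<longrightarrow> few_pluses P i j)"

lemma outside_flip_cols: "outside n m t u v w i (m - 2 - j) \<longleftrightarrow> outside n m u t w v i j"
  unfolding outside_def by auto

lemma outside_flip_rows: "outside n m t u v w (n - 2 - i) j \<longleftrightarrow> outside n m v w t u i j"
  unfolding outside_def by auto

lemma sea_flip_cols: "sea n m P t u v w \<Longrightarrow> sea n m (flip_cols m P) u t w v"
  unfolding sea_def using outside_flip_cols[of n m t u v w]
    by (auto simp: no_zero_square_flip_cols few_pluses_flip_cols)

lemma sea_flip_rows: "sea n m P t u v w \<Longrightarrow> sea n m (flip_rows n P) v w t u"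
  unfolding sea_def using outside_flip_rows[of n m t u v w]
    by (auto simp: no_zero_square_flip_rows few_pluses_flip_rows)

lemma small_triangle_bound:
  assumes "t = 0 \<or> small_triangle n m P t c" "n \<le> m" "m \<le> n + 1" "2 \<le> n"
  shows "0 \<le> t" "t \<le> n - 2"
  using assms unfolding small_triangle_def by auto

text \<open>
The bound of \<open>corner_triangle_vertical\<close>, weakened by one so that it also covers an absent triangle.
\<close>

lemma small_triangle_vertical:
  assumes "t = 0 \<or> small_triangle n m P t c" "v = 0 \<or> small_triangle n m (flip_rows n P) v c'"
    and nm: "n \<le> m" "m \<le> n + 1" "2 \<le> n"
  shows "t + v \<le> n - 2"
proof (cases "t = 0 \<or> v = 0")
  case True then show ?thesis
    using small_triangle_bound[OF assms(1) nm] small_triangle_bound[OF assms(2) nm] by auto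
next
  case False
  then have "t + v \<le> n - 3"
    using assms small_triangle_bound[OF assms(1) nm] small_triangle_bound[OF assms(2) nm]
    by (intro corner_triangle_vertical[of n m P t c v c']) (auto simp: small_triangle_def)
  then show ?thesis by simp
qed

lemma small_triangle_horizontal:
  assumes "t = 0 \<or> small_triangle n m P t c" "u = 0 \<or> small_triangle n m (flip_cols m P) u c'"
    and nm: "n \<le> m" "m \<le> n + 1" "2 \<le> n"
  shows "t + u \<le> m - 2"
proof (cases "t = 0 \<or> u = 0")
  case True then show ?thesis
    using small_triangle_bound[OF assms(1) nm] small_triangle_bound[OF assms(2) nm] nm by auto
next
  case False
  then have "t + u \<le> m - 3"
    using assms small_triangle_bound[OF assms(1) nm] small_triangle_bound[OF assms(2) nm]
    by (intro corner_triangle_horizontal[of n m P t c u c']) (auto simp: small_triangle_def)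
  then show ?thesis by simp
qed

lemma small_triangle_opposite:
  assumes "t = 0 \<or> small_triangle n m P t c" "w = 0 \<or>
    small_triangle n m (flip_cols m (flip_rows n P)) w c'" and nm: "n \<le> m" "m \<le> n + 1" "3 \<le> n"
  shows "t + w \<le> n + m - 5"
proof (cases "t = 0 \<or> w = 0")
  case True then show ?thesis
    using small_triangle_bound[OF assms(1)] small_triangle_bound[OF assms(2)] nm by auto
next
  case False
  then show ?thesis using assms
    by (intro corner_triangle_opposite[of n m P t c w c']) (auto simp: small_triangle_def)
qed

text \<open>
The window behind the upper end of the border of a triangle contains two cells of the opposite
colour; if its majority is minus, this colour is minus.
\<close>

lemma sea_colour:
  assumes "small_triangle n m P t c" "few_pluses P 0 t" "n \<le> m" "m \<le> n + 1" "2 \<le> n"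
  shows "small_triangle n m P t True"
proof -
  have s: "corner_triangle n m P t c" and t: "1 \<le> t" "t \<le> n - 2"
    using assms small_triangle_bound[of t n m P c] unfolding small_triangle_def by auto
  have "P 0 (t + 1) = (\<not> c)" by (rule corner_triangle_out[OF s]) (use t assms in auto)
  moreover have "P (0 + 1) t = (\<not> c)" by (rule corner_triangle_out[OF s]) (use t assms in auto)
  ultimately have c using assms(2) unfolding few_pluses_iff by auto
  then show ?thesis using assms(1) by simp
qed

lemma small_triangle_unique:
  assumes "small_triangle n m P t c" "small_triangle n m P t' c'" "n \<le> m" "m \<le> n + 1" "2 \<le> n"
  shows "t = t'"
  using assms small_triangle_bound[of t n m P c] small_triangle_bound[of t' n m P c']
  by (intro corner_triangle_unique[of n m P t c t' c']) (auto simp: small_triangle_def)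

lemma small_triangle_negated: "small_triangle n m (negated P) t c \<longleftrightarrow> small_triangle n m P t (\<not> c)"
  unfolding small_triangle_def corner_triangle_def negated_def by auto

text \<open>
By \<open>majority_change_horizontal\<close> and \<open>majority_change_vertical\<close> the majority is constant on the
connected set of windows outside all triangles. If it is plus, all signs are exchanged.
\<close>

lemma sea_exists:
  assumes f: "no_zero_square n m P" and nm: "n \<le> m" "m \<le> n + 1" "5 \<le> n"
    and ns: "\<not> diagonal_split n m P" "\<not> diagonal_split n m (flip_cols m P)"
  shows "\<exists>t u v w. sea n m P t u v w \<or> sea n m (negated P) t u v w"
proof -
  have size: "\<exists>t. (t = 0 \<or> (\<exists>c. small_triangle n m Q t c)) \<and> (\<forall>t' c. small_triangle n m Q t' c \<longrightarrow>
    t' = t)" for Q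
  proof (cases "\<exists>t c. small_triangle n m Q t c")
    case True
    then obtain t c where "small_triangle n m Q t c" by blast
    moreover have "t' = t" if "small_triangle n m Q t' c'" for t' c'
      by (rule small_triangle_unique[OF that calculation]) (use nm in auto)
    ultimately show ?thesis by blast
  qed blast
  obtain t where t: "t = 0 \<or> (\<exists>c. small_triangle n m P t c)"
    "\<And>t' c. small_triangle n m P t' c \<Longrightarrow> t' = t" using size by blast
  obtain u where u: "u = 0 \<or> (\<exists>c. small_triangle n m (flip_cols m P) u c)"
    "\<And>t' c. small_triangle n m (flip_cols m P) t' c \<Longrightarrow> t' = u" using size by blast
  obtain v where v: "v = 0 \<or> (\<exists>c. small_triangle n m (flip_rows n P) v c)"
    "\<And>t' c. small_triangle n m (flip_rows n P) t' c \<Longrightarrow> t' = v" using size by blast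
  obtain w where w: "w = 0 \<or> (\<exists>c. small_triangle n m (flip_cols m (flip_rows n P)) w c)"
    "\<And>t' c. small_triangle n m (flip_cols m (flip_rows n P)) t' c \<Longrightarrow> t' = w" using size by blast
  from t(1) obtain ct where ct: "t = 0 \<or> small_triangle n m P t ct" by blast
  from u(1) obtain cu where cu: "u = 0 \<or> small_triangle n m (flip_cols m P) u cu" by blast
  from v(1) obtain cv where cv: "v = 0 \<or> small_triangle n m (flip_rows n P) v cv" by blast
  from w(1) obtain cw where cw: "w = 0 \<or> small_triangle n m (flip_cols m (flip_rows n P)) w cw" by blast
  have n3: "2 \<le> n" "3 \<le> n" "3 \<le> m" using nm by auto
  have bd: "t + u \<le> m - 2" "v + w \<le> m - 2" "t + w \<le> n + m - 5" "u + v \<le> n + m - 5" "t + v \<le> n - 2"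
    "u + w \<le> n - 2"
    "0 \<le> t" "0 \<le> u" "0 \<le> v" "0 \<le> w" "t \<le> n - 2" "u \<le> n - 2" "v \<le> n - 2" "w \<le> n - 2"
    using small_triangle_horizontal[OF ct cu nm(1,2) n3(1)] small_triangle_horizontal[OF cv cw nm(1,2)
      n3(1)]
      small_triangle_opposite[OF ct cw nm(1,2) n3(2)] small_triangle_opposite[OF cu _ nm(1,2) n3(2), of
        v cv] cv
      small_triangle_vertical[OF ct cv nm(1,2) n3(1)] small_triangle_vertical[OF cu _ nm(1,2) n3(1), of
        w cw] cw
      small_triangle_bound[OF ct nm(1,2) n3(1)] small_triangle_bound[OF cu nm(1,2) n3(1)]
        small_triangle_bound[OF cv nm(1,2) n3(1)] small_triangle_bound[OF cw nm(1,2) n3(1)]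
    by (simp_all add: add.commute)
  have "\<exists>b. \<forall>i j. outside n m t u v w i j \<longrightarrow> few_pluses P i j = b"
  proof (rule outside_connected)
    fix i j assume o: "outside n m t u v w i j" "outside n m t u v w i (j + 1)"
    show "few_pluses P i j = few_pluses P i (j + 1)"
    proof (rule ccontr)
      assume d: "few_pluses P i j \<noteq> few_pluses P i (j + 1)"
      have "i + j + 1 = t \<or> i + (m - 2 - j) = u \<or> n - 2 - i + j + 1 = v \<or> n - 2 - i + (m - 2 - j) = w"
        using majority_change_horizontal[OF f nm(1,2) _ _ _ _ d ns] t(2) u(2) v(2) w(2) o
          unfolding outside_def by auto
      then show False using o unfolding outside_def by auto
    qed
  next
    fix i j assume o: "outside n m t u v w i j" "outside n m t u v w (i + 1) j"
    show "few_pluses P i j = few_pluses P (i + 1) j"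
    proof (rule ccontr)
      assume d: "few_pluses P i j \<noteq> few_pluses P (i + 1) j"
      have "i + j + 1 = t \<or> i + 1 + (m - 2 - j) = u \<or> n - 2 - i + j = v \<or> n - 2 - i + (m - 2 - j) = w"
        using majority_change_vertical[OF f nm(1,2) n3(3) _ _ _ _ d ns] t(2) u(2) v(2) w(2) o
          unfolding outside_def by auto
      then show False using o unfolding outside_def by auto
    qed
  qed (use bd n3 in auto)
  then obtain b where b: "\<And>i j. outside n m t u v w i j \<Longrightarrow> few_pluses P i j = b" by blast
  have good: "sea n m Q t u v w" if fQ: "no_zero_square n m Q"
    and fw: "\<And>i j. outside n m t u v w i j \<Longrightarrow> few_pluses Q i j"
    and c: "t = 0 \<or> small_triangle n m Q t ct" "u = 0 \<or> small_triangle n m (flip_cols m Q) u cu"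
      "v = 0 \<or> small_triangle n m (flip_rows n Q) v cv"
      "w = 0 \<or> small_triangle n m (flip_cols m (flip_rows n Q)) w cw" for Q ct cu cv cw
  proof -
    have "few_pluses Q 0 t" by (rule fw) (use bd n3 in \<open>auto simp: outside_def\<close>)
    moreover have "few_pluses (flip_cols m Q) 0 u" unfolding few_pluses_flip_cols
      by (rule fw) (use bd n3 in \<open>auto simp: outside_def\<close>)
    moreover have "few_pluses (flip_rows n Q) 0 v" unfolding few_pluses_flip_rows
      by (rule fw) (use bd n3 in \<open>auto simp: outside_def\<close>)
    moreover have "few_pluses (flip_cols m (flip_rows n Q)) 0 w"
      unfolding few_pluses_flip_rows few_pluses_flip_cols
      by (rule fw) (use bd n3 in \<open>auto simp: outside_def\<close>)
    ultimately show ?thesis unfolding sea_def using fQ fw c sea_colour nm n3 by metis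
  qed
  show ?thesis
  proof (cases b)
    case True
    then have "sea n m P t u v w" using b ct cu cv cw by (intro good[OF f]) auto
    then show ?thesis by blast
  next
    case False
    have "few_pluses (negated P) i j" if "outside n m t u v w i j" for i j
      using few_pluses_negated[OF f, of i j] b[OF that] that False unfolding outside_def by auto
    then have "sea n m (negated P) t u v w"
      using ct cu cv cw f
        by (intro good[of "negated P" "\<not> ct" "\<not> cu" "\<not> cv" "\<not> cw"])
          (auto simp: small_triangle_negated flip_cols_negated flip_rows_negated)
    then show ?thesis by blast
  qed
qed

section \<open>Corner triangles exclude each other\<close>

text \<open>
Squares with both left corners on the two plus segments at the ends of the first column must have
another plus cell on their right side. Three such squares demand three plus cells, which all lie in
the two given windows.
\<close>

lemma two_corners:
  assumes f: "no_zero_square n m P"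
    and p: "\<And>x. 0 \<le> x \<Longrightarrow> x \<le> t \<Longrightarrow> P x 0" "\<And>y. 0 \<le> y \<Longrightarrow> y \<le> v \<Longrightarrow> P (n - 1 - y) 0"
    and b: "1 \<le> t" "1 \<le> v" and h: "h = n - 1 - t - v" "1 \<le> h" "h + 1 < m"
    and w: "few_pluses P (t - 1) h" "few_pluses P (n - 1 - v) h"
  shows False
proof -
  have "\<not> balanced (P t 0) (P t h) (P (n - 1 - v) 0) (P (n - 1 - v) h)"
    using b h by (intro no_zero_squareD[OF f]) auto
  moreover have "\<not> balanced (P (t - 1) 0) (P (t - 1) (h + 1)) (P (n - 1 - v) 0) (P (n - 1 - v) (h + 1))"
    using b h by (intro no_zero_squareD[OF f]) auto
  moreover have "\<not> balanced (P t 0) (P t (h + 1)) (P (n - v) 0) (P (n - v) (h + 1))"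
    using b h by (intro no_zero_squareD[OF f]) auto
  moreover have "P t 0" "P (t - 1) 0" "P (n - 1 - v) 0" using p b by auto
  moreover have "P (n - v) 0" using p(2)[of "v - 1"] b by simp
  moreover have "t - 1 + 1 = t" "n - 1 - v + 1 = n - v" by auto
  ultimately show False using w unfolding few_pluses_iff balanced_def by metis
qed

lemma sea_bounds:
  assumes s: "sea n m P t u v w" and nm: "n \<le> m" "m \<le> n + 1" "5 \<le> n"
  shows "0 \<le> t" "0 \<le> u" "0 \<le> v" "0 \<le> w" "t \<le> n - 2" "u \<le> n - 2" "v \<le> n - 2" "w \<le> n - 2"
    "1 \<le> t \<Longrightarrow> 1 \<le> v \<Longrightarrow> t + v \<le> n - 3" "1 \<le> t \<Longrightarrow> 1 \<le> u \<Longrightarrow> t + u \<le> m - 3"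
proof -
  have n2: "2 \<le> n" using nm by simp
  have T: "t = 0 \<or> small_triangle n m P t True" "u = 0 \<or> small_triangle n m (flip_cols m P) u True"
    "v = 0 \<or> small_triangle n m (flip_rows n P) v True"
      "w = 0 \<or> small_triangle n m (flip_cols m (flip_rows n P)) w True"
    using s unfolding sea_def by auto
  show B: "0 \<le> t" "0 \<le> u" "0 \<le> v" "0 \<le> w" "t \<le> n - 2" "u \<le> n - 2" "v \<le> n - 2" "w \<le> n - 2"
    using small_triangle_bound[OF T(1) nm(1,2) n2] small_triangle_bound[OF T(2) nm(1,2) n2]
      small_triangle_bound[OF T(3) nm(1,2) n2]
      small_triangle_bound[OF T(4) nm(1,2) n2] by auto
  show "t + v \<le> n - 3" if "1 \<le> t" "1 \<le> v"
    using T B that nm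
      by (intro corner_triangle_vertical[of n m P t True v True]) (auto simp: small_triangle_def)
  show "t + u \<le> m - 3" if "1 \<le> t" "1 \<le> u"
    using T B that nm
      by (intro corner_triangle_horizontal[of n m P t True u True]) (auto simp: small_triangle_def)
qed

lemma sea_triangle_plus:
  assumes "sea n m P t u v w" "1 \<le> t" "n \<le> m" "0 \<le> i" "0 \<le> j" "i + j \<le> t" "i < n" "j < m"
  shows "P i j"
proof -
  have "corner_triangle n m P t True" using assms unfolding sea_def small_triangle_def by auto
  from corner_triangle_in[OF this] show ?thesis using assms by auto
qed

text \<open>
The two windows of \<open>two_corners\<close>, chosen as near to the first column as possible, lie in the sea.
For the triangles in the other two corners this uses that \<open>t\<close> is the largest size.
\<close>

lemma no_vertical_neighbour:
  assumes s: "sea n m P t u v w" and nm: "n \<le> m" "m \<le> n + 1" "5 \<le> n"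
    and b: "1 \<le> t" "u \<le> t" "w \<le> t" "1 \<le> v"
  shows False
proof -
  note B = sea_bounds[OF s nm]
  have tv: "t + v \<le> n - 3" using B b by simp
  have few_pluses: "few_pluses P i j" if "outside n m t u v w i j" for i j using s that
    unfolding sea_def by auto
  show False
  proof (rule two_corners[of n m P t v "n - 1 - t - v"])
    show "no_zero_square n m P" using s unfolding sea_def by simp
    show "P x 0" if "0 \<le> x" "x \<le> t" for x using sea_triangle_plus[OF s b(1) nm(1)] that B nm by auto
    show "P (n - 1 - y) 0" if "0 \<le> y" "y \<le> v" for y
      using sea_triangle_plus[OF sea_flip_rows[OF s] b(4) nm(1), of y 0] that B nm
        by (auto simp: flip_rows_def)
    show "few_pluses P (t - 1) (n - 1 - t - v)"
      by (rule few_pluses) (use tv b B nm in \<open>auto simp: outside_def\<close>)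
    show "few_pluses P (n - 1 - v) (n - 1 - t - v)"
      by (rule few_pluses) (use tv b B nm in \<open>auto simp: outside_def\<close>)
  qed (use tv b nm in auto)
qed

text \<open>
The transposed argument. Here one of the windows can meet the triangle at the bottom right corner,
but only if that triangle has the largest size as well; then it has a vertical neighbour of size
\<open>u\<close>, which is excluded already.
\<close>

lemma no_horizontal_neighbour:
  assumes s: "sea n m P t u v w" and nm: "n \<le> m" "m \<le> n + 1" "5 \<le> n"
    and b: "1 \<le> t" "u \<le> t" "v \<le> t" "w \<le> t" "1 \<le> u"
  shows False
proof -
  note B = sea_bounds[OF s nm]
  have tu: "t + u \<le> m - 3" using B b by simp
  have v: "v = 0" using no_vertical_neighbour[OF s nm b(1,2,4)] B(3) by (cases "1 \<le> v") auto
  have "\<not> (w = t \<and> u = 1)"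
    using no_vertical_neighbour[OF sea_flip_cols[OF sea_flip_rows[OF s]] nm] b v by auto
  then have w: "w < t \<or> 2 \<le> u" using b by linarith
  have few_pluses: "few_pluses P i j" if "outside n m t u v w i j" for i j using s that
    unfolding sea_def by auto
  show False
  proof (rule two_corners[of m n "transposed P" t u "m - 1 - t - u"])
    show "no_zero_square m n (transposed P)" using s no_zero_square_transposed unfolding sea_def by simp
    show "transposed P x 0" if "0 \<le> x" "x \<le> t" for x using sea_triangle_plus[OF s b(1) nm(1)] that B nm
      by (auto simp: transposed_def)
    show "transposed P (m - 1 - y) 0" if "0 \<le> y" "y \<le> u" for y
      using sea_triangle_plus[OF sea_flip_cols[OF s] b(5) nm(1), of 0 y] that B nm
        by (auto simp: flip_cols_def transposed_def)
    show "few_pluses (transposed P) (t - 1) (m - 1 - t - u)" unfolding few_pluses_transposed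
      by (rule few_pluses) (use tu b v B nm in \<open>auto simp: outside_def\<close>)
    show "few_pluses (transposed P) (m - 1 - u) (m - 1 - t - u)" unfolding few_pluses_transposed
      by (rule few_pluses) (use tu b v w B nm in \<open>auto simp: outside_def\<close>)
  qed (use tu b nm in auto)
qed

text \<open>
Squares with two opposite corners on the two triangles must have a plus cell at one of the other two
corners. Four such squares near the corners of the matrix demand more plus cells than the windows of
the sea at the other two corners can contain.
\<close>

lemma no_opposite_island:
  assumes s: "sea n m P t 0 0 w" and nm: "n \<le> m" "m \<le> n + 1" "5 \<le> n"
    and b: "2 \<le> t" "w \<le> t" "1 \<le> w"
  shows False
proof -
  note B = sea_bounds[OF s nm]
  have few_pluses: "few_pluses P i j" if "outside n m t 0 0 w i j" for i j using s that
    unfolding sea_def by auto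
  have w1: "few_pluses P 0 (m - 2)" by (rule few_pluses) (use b B nm in \<open>auto simp: outside_def\<close>)
  have w2: "few_pluses P (n - 2) 0" by (rule few_pluses) (use b B nm in \<open>auto simp: outside_def\<close>)
  have cl: "P a (m - 1 - y) \<or> P (n - 1 - b) x"
    if "0 \<le> a" "0 \<le> b" "0 \<le> x" "0 \<le> y" "a + x \<le> 2" "b + y \<le> 1"
      "x + y = a + b + (m - n)" for a b x y :: int
  proof -
    have t: "1 \<le> t" using \<open>2 \<le> t\<close> by simp
    have "P a x" using sea_triangle_plus[OF s t nm(1), of a x] that \<open>2 \<le> t\<close> nm by auto
    moreover have "P (n - 1 - b) (m - 1 - y)"
      using sea_triangle_plus[OF sea_flip_cols[OF sea_flip_rows[OF s]] \<open>1 \<le> w\<close> nm(1), of b y] that \<open>1 \<le>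
        w\<close> nm by (auto simp: flip_cols_def flip_rows_def)
    moreover have "\<not> balanced (P a x) (P a (m - 1 - y)) (P (n - 1 - b) x) (P (n - 1 - b) (m - 1 - y))"
      using that nm s unfolding sea_def by (intro no_zero_squareD[of n m P]) auto
    ultimately show ?thesis unfolding balanced_def by auto
  qed
  have e: "m - 1 - 0 = m - 1" "m - 1 - 1 = m - 2" "n - 1 - 0 = n - 1" "n - 1 - 1 = n - 2"
    "m - 2 + 1 = m - 1" "n - 2 + 1 = n - 1" "0 + 1 = (1::int)" "1 + 1 = (2::int)" by auto
  consider "m = n" | "m = n + 1" using nm by linarith
  then show False
  proof cases
    case 1
    have "P 0 (m - 1) \<or> P (n - 1) 0" using cl[of 0 0 0 0] 1 by simp
    moreover have "P 0 (m - 1) \<or> P (n - 2) 1" using cl[of 0 1 1 0] 1 by simp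
    moreover have "P 1 (m - 2) \<or> P (n - 1) 0" using cl[of 1 0 0 1] 1 by simp
    moreover have "P 1 (m - 1) \<or> P (n - 1) 1" using cl[of 1 0 1 0] 1 by simp
    ultimately show False using w1 w2 unfolding few_pluses_iff e by satx
  next
    case 2
    have w3: "few_pluses P (n - 2) 1" by (rule few_pluses) (use 2 b B nm in \<open>auto simp: outside_def\<close>)
    have "P 0 (m - 1) \<or> P (n - 1) 1" using cl[of 0 0 1 0] 2 by simp
    moreover have "P 0 (m - 2) \<or> P (n - 1) 0" using cl[of 0 0 0 1] 2 by simp
    moreover have "P 0 (m - 1) \<or> P (n - 2) 2" using cl[of 0 1 2 0] 2 by simp
    moreover have "P 1 (m - 2) \<or> P (n - 1) 1" using cl[of 1 0 1 1] 2 by simp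
    ultimately show False using w1 w2 w3 unfolding few_pluses_iff e by satx
  qed
qed

section \<open>The strip cleared by a triangle\<close>

lemma few_plusesD:
  assumes "few_pluses P x y" "P a b" "P a' b'" "a \<in> {x, x + 1}" "a' \<in> {x, x + 1}" "b \<in> {y, y + 1}"
    "b' \<in> {y, y + 1}"
  shows "a = a' \<and> b = b'"
  using assms unfolding few_pluses_def by blast

context
  fixes n m t :: int and P :: "int \<Rightarrow> int \<Rightarrow> bool"
  assumes f: "no_zero_square n m P" and s: "corner_triangle n m P t True"
    and t: "2 \<le> t" "t \<le> n - 2" "t \<le> m - 2"
    and few_pluses: "\<And>i j. 0 \<le> i \<Longrightarrow> i + 1 < n \<Longrightarrow> 0 \<le> j \<Longrightarrow> j + 1 < m \<Longrightarrow> t \<le> i + j \<Longrightarrow> few_pluses P i j"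
begin

lemma triangle_plus: "0 \<le> i \<Longrightarrow> 0 \<le> j \<Longrightarrow> i + j \<le> t \<Longrightarrow> P i j"
  using corner_triangle_in[OF s, of i j] t by auto

text \<open>
Apart from the diagonal next to the triangle, which has no plus cells, the cells beyond the triangle
are covered by windows of the sea, also together with any of their neighbours.
\<close>

lemma isolated:
  assumes "P i j" "0 \<le> i" "i < n" "0 \<le> j" "j < m" "t + 2 \<le> i + j"
    "0 \<le> i'" "i' < n" "0 \<le> j'" "j' < m" "i - 1 \<le> i'" "i' \<le> i + 1" "j - 1 \<le> j'" "j' \<le> j + 1"
      "(i', j') \<noteq> (i, j)"
  shows "\<not> P i' j'"
proof
  assume p: "P i' j'"
  define x where "x = (if i' < i \<or> i = n - 1 then i - 1 else i)"
  define y where "y = (if j' < j \<or> j = m - 1 then j - 1 else j)"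
  have "few_pluses P x y" by (rule few_pluses) (use assms t in \<open>auto simp: x_def y_def\<close>)
  moreover have "i \<in> {x, x + 1}" "i' \<in> {x, x + 1}" using assms(2-) by (auto simp: x_def)
  moreover have "j \<in> {y, y + 1}" "j' \<in> {y, y + 1}" using assms(2-) by (auto simp: y_def)
  ultimately have "i = i' \<and> j = j'" using few_plusesD assms(1) p by blast
  then show False using assms by simp
qed

text \<open>
A plus cell \<open>(i, j)\<close> behind the triangle, at distance at most \<open>t\<close> from the diagonal of the matrix, is
not near the triangle: otherwise some square has its first corner in the triangle, its last corner at
\<open>(i, j)\<close>, and the other two on the minus diagonal next to the triangle.
\<close>

lemma isolated_far:
  assumes p: "P i j" and b: "0 \<le> i" "i \<le> j" "i < n" "j < m" "t + 1 \<le> i + j" "j - i \<le> t"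
  shows "t + 2 \<le> j" "2 \<le> i"
proof -
  have d: "t + 2 \<le> i + j" using corner_triangle_out[OF s, of i j] p b by force
  show "t + 2 \<le> j"
  proof (rule ccontr)
    assume n: "\<not> t + 2 \<le> j"
    \<comment> \<open>the offset for which both remaining corners lie on diagonal \<open>t + 1\<close>\<close>
    define x where "x = t + 1 - j"
    have "\<not> balanced (P x (j - i + x)) (P x j) (P i (j - i + x)) (P i j)"
      using b d n by (intro no_zero_squareD[OF f]) (auto simp: x_def)
    moreover have "P x (j - i + x)" by (rule triangle_plus) (use b d n in \<open>auto simp: x_def\<close>)
    moreover have "P x j = (\<not> True)"
      by (rule corner_triangle_out[OF s]) (use b d n in \<open>auto simp: x_def\<close>)
    moreover have "P i (j - i + x) = (\<not> True)"
      by (rule corner_triangle_out[OF s]) (use b d n in \<open>auto simp: x_def\<close>)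
    ultimately show False using p unfolding balanced_def by auto
  qed
  then show "2 \<le> i" using b by simp
qed

text \<open>
The square that projects \<open>(i, j)\<close> to the first row along the diagonal has plus cells at two opposite
corners, so one of the other two is a plus cell, too. It is again isolated, and in the following
lemmas squares next to this one produce neighbouring plus cells.
\<close>

lemma shadow:
  assumes p: "P i j" and b: "0 \<le> i" "i \<le> j" "i < n" "j < m" "t + 1 \<le> i + j" "j - i \<le> t"
  shows "P 0 j \<or> P i (j - i)"
proof -
  note isolated_far[OF p b]
  moreover have "\<not> balanced (P 0 (j - i)) (P 0 j) (P i (j - i)) (P i j)"
    using b calculation by (intro no_zero_squareD[OF f]) auto
  moreover have "P 0 (j - i)" using b by (intro triangle_plus) auto
  ultimately show ?thesis using p unfolding balanced_def by auto
qed

lemma strip_inner: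
  assumes b: "0 \<le> i" "i \<le> j" "i < n" "j < m" "t + 1 \<le> i + j" "j - i \<le> t - 2"
  shows "\<not> P i j"
proof
  assume p: "P i j"
  have nr: "t + 2 \<le> j" "2 \<le> i" using isolated_far[OF p] b by auto
  define d where "d = j - i"
  have d: "0 \<le> d" "d \<le> t - 2" "j = i + d" using b unfolding d_def by auto
  have tl: "P 0 (d + 1)" "P 1 (d + 1)" "P 1 d" using d by (auto intro!: triangle_plus)
  have sq: "\<not> balanced (P 0 (d + 1)) (P 0 j) (P (i - 1) (d + 1)) (P (i - 1) j)"
      "\<not> balanced (P 1 (d + 1)) (P 1 j) (P i (d + 1)) (P i j)"
      "\<not> balanced (P 1 d) (P 1 (j - 1)) (P i d) (P i (j - 1))"
    by (insert b nr d, (rule no_zero_squareD[OF f]; auto)+)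
  have ng: "\<not> P (i - 1) j" "\<not> P i (j - 1)" by (insert b nr, (rule isolated[OF p]; auto)+)
  show False
  proof (cases "P 0 j")
    case True
    have "\<not> P 1 j" by (rule isolated[OF True]) (use b nr in auto)
    then have "P i (d + 1)" using sq tl p unfolding balanced_def by blast
    moreover have "P (i - 1) (d + 1)" using sq tl ng True unfolding balanced_def by blast
    moreover have "\<not> P (i - 1) (d + 1)" if "P i (d + 1)" by (rule isolated[OF that]) (use b nr d in auto)
    ultimately show False by blast
  next
    case False
    then have q: "P i d" using shadow[OF p] b unfolding d_def by auto
    have "P 1 (j - 1)" using sq tl ng q unfolding balanced_def by blast
    moreover have "\<not> P i (d + 1)" by (rule isolated[OF q]) (use b nr d in auto)
    then have "P 1 j" using sq tl p unfolding balanced_def by blast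
    moreover have "\<not> P 1 (j - 1)" if "P 1 j" by (rule isolated[OF that]) (use b nr d in auto)
    ultimately show False by blast
  qed
qed

lemma strip_shadow:
  assumes p: "P i j" and b: "0 \<le> i" "i + 1 < n" "i < j" "j < m" "t + 1 \<le> i + j" "j - i \<le> t"
  shows "\<not> P 0 j" "P i (j - i)" "\<not> P 1 (j - 1)" "2 \<le> i"
proof -
  have nr: "t + 2 \<le> j" "2 \<le> i" using isolated_far[OF p] b by auto
  then show "2 \<le> i" by simp
  define d where "d = j - i"
  have d: "1 \<le> d" "d \<le> t" "j = i + d" using b unfolding d_def by auto
  have tl: "P 0 (d - 1)" "P 1 (d - 1)" using d by (auto intro!: triangle_plus)
  have sq: "\<not> balanced (P 0 (d - 1)) (P 0 j) (P (i + 1) (d - 1)) (P (i + 1) j)"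
      "\<not> balanced (P 1 (d - 1)) (P 1 (j - 1)) (P (i + 1) (d - 1)) (P (i + 1) (j - 1))"
    by (insert b nr d, (rule no_zero_squareD[OF f]; auto)+)
  have ng: "\<not> P (i + 1) j" "\<not> P (i + 1) (j - 1)" by (insert b nr, (rule isolated[OF p]; auto)+)
  show np: "\<not> P 0 j"
  proof
    assume q: "P 0 j"
    have "\<not> P 1 (j - 1)" by (rule isolated[OF q]) (use b nr in auto)
    then show False using sq tl ng q unfolding balanced_def by blast
  qed
  then show q: "P i (j - i)" using shadow[OF p] b by auto
  have "\<not> P (i + 1) (j - i - 1)" by (rule isolated[OF q]) (use b nr in auto)
  then show "\<not> P 1 (j - 1)" using sq tl ng unfolding balanced_def d_def by blast
qed

lemma strip_outer:
  assumes b: "0 \<le> i" "i + 1 < n" "i < j" "j < m" "t + 1 \<le> i + j" "j - i \<le> t - 1"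
  shows "\<not> P i j"
proof
  assume p: "P i j"
  have sh: "P i (j - i)" "\<not> P 1 (j - 1)" "2 \<le> i" using strip_shadow[OF p] b by auto
  have "\<not> balanced (P 1 (j - i)) (P 1 (j - 1)) (P i (j - i)) (P i (j - 1))"
    using b sh by (intro no_zero_squareD[OF f]) auto
  moreover have "P 1 (j - i)" using b by (intro triangle_plus) auto
  moreover have "\<not> P i (j - 1)" using isolated_far[OF p] b by (intro isolated[OF p]) auto
  ultimately show False using sh unfolding balanced_def by blast
qed

end

text \<open>
On the edge of the strip \<open>strip_shadow\<close> leaves only the shadow \<open>(i, t)\<close>; for small \<open>i\<close> this cell lies in
the interior of the strip, possibly on the other side of the diagonal.
\<close>

lemma strip_edge:
  assumes f: "no_zero_square n m P" and s: "corner_triangle n m P t True"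
    and t: "2 \<le> t" "t \<le> n - 2" "t \<le> m - 2"
    and few_pluses: "\<And>i j. 0 \<le> i \<Longrightarrow> i + 1 < n \<Longrightarrow> 0 \<le> j \<Longrightarrow> j + 1 < m \<Longrightarrow> t \<le> i + j \<Longrightarrow> few_pluses P i j"
    and b: "0 \<le> i" "i + 1 < n" "j < m" "t + 1 \<le> i + j" "j = i + t" "i \<le> 2 * t - 1"
  shows "\<not> P i j"
proof
  assume p: "P i j"
  have few_pluses': "few_pluses (transposed P) x y" if "0 \<le> x" "x + 1 < m" "0 \<le> y" "y + 1 < n"
    "t \<le> x + y" for x y
    unfolding few_pluses_transposed using that by (intro few_pluses) auto
  have sh: "P i t" "2 \<le> i" using strip_shadow[OF f s t few_pluses p] b t by auto
  show False
  proof (cases "i \<le> t")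
    case True
    then show False using strip_inner[OF f s t few_pluses, of i t] sh t b by auto
  next
    case False
    have "\<not> transposed P t i" using False t b
      by (intro strip_outer[OF no_zero_square_transposed[OF f] corner_triangle_transposed[OF s] _ _ _
        few_pluses']) auto
    then show False using sh by (simp add: transposed_def)
  qed
qed

section \<open>Counting isolated cells\<close>

definition plus_cells :: "int \<Rightarrow> int \<Rightarrow> (int \<Rightarrow> int \<Rightarrow> bool) \<Rightarrow> (int \<times> int) set" where
  "plus_cells n m P = {(i, j). 0 \<le> i \<and> i < n \<and> 0 \<le> j \<and> j < m \<and> P i j}"

definition sparse :: "(int \<times> int) set \<Rightarrow> bool" where
  "sparse A \<longleftrightarrow> (\<forall>i j i' j'. (i, j) \<in> A \<longrightarrow> (i', j') \<in> A \<longrightarrow> \<bar>i - i'\<bar> \<le> 1 \<longrightarrow> \<bar>j - j'\<bar> \<le> 1 \<longrightarrow> i = i' \<and> j = j')"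

text \<open>
The aligned windows that tile the quadrant, numbered by row and column.
\<close>

definition block :: "int \<times> int \<Rightarrow> int \<times> int" where
  "block = (\<lambda>(i, j). (i div 2, j div 2))"

lemma sparse_inj_on_block: assumes "sparse A" shows "inj_on block A"
proof (rule inj_onI)
  fix a b assume a: "a \<in> A" "b \<in> A" "block a = block b"
  obtain i j i' j' where ab: "a = (i, j)" "b = (i', j')" by (metis surj_pair)
  have "\<bar>i - i'\<bar> \<le> 1" "\<bar>j - j'\<bar> \<le> 1" using a(3) unfolding ab block_def by auto
  then show "a = b" using assms a(1,2) unfolding ab sparse_def by blast
qed

lemma finite_plus_cells [simp]: "finite (plus_cells n m P)"
  by (rule finite_subset[of _ "{0..<n} \<times> {0..<m}"]) (auto simp: plus_cells_def)

text \<open>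
Each aligned window contains at most one element of a sparse set.
\<close>

lemma sparse_card_box:
  assumes "sparse A" "A \<subseteq> {0..<n} \<times> {0..<m}" "0 \<le> n" "0 \<le> m"
  shows "int (card A) \<le> ((n + 1) div 2) * ((m + 1) div 2)"
proof -
  let ?B = "{0..<(n + 1) div 2} \<times> {0..<(m + 1) div 2}"
  have "block ` A \<subseteq> ?B"
  proof
    fix b assume "b \<in> block ` A"
    then obtain i j where ij: "(i, j) \<in> A" "b = (i div 2, j div 2)" by (auto simp: block_def)
    then have "0 \<le> i" "i < n" "0 \<le> j" "j < m" using assms(2) by auto
    then show "b \<in> ?B" unfolding ij(2) by auto
  qed
  then have "card (block ` A) \<le> card ?B" by (intro card_mono) auto
  then have "card A \<le> card ?B" by (simp add: card_image[OF sparse_inj_on_block[OF assms(1)]])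
  then have "int (card A) \<le> int (card ?B)" by (simp only: of_nat_le_iff)
  also have "int (card ?B) = ((n + 1) div 2) * ((m + 1) div 2)"
    using assms by (simp add: card_cartesian_product)
  finally show ?thesis .
qed

definition staircase :: "int \<Rightarrow> (int \<times> int) set" where
  "staircase k = {(i, j). 0 \<le> i \<and> 0 \<le> j \<and> i + j < k}"

lemma finite_staircase [simp]: "finite (staircase k)"
  by (rule finite_subset[of _ "{0..<k} \<times> {0..<k}"]) (auto simp: staircase_def)

lemma card_staircase_nat: "2 * card (staircase (int k)) = k * (k + 1)"
proof (induction k)
  case 0
  have "staircase 0 = {}" by (auto simp: staircase_def)
  then show ?case by simp
next
  case (Suc k)
  let ?D = "(\<lambda>i. (i, int k - i)) ` {0..int k}"
  have "staircase (int (Suc k)) = staircase (int k) \<union> ?D" by (auto simp: staircase_def)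
  moreover have "staircase (int k) \<inter> ?D = {}" by (auto simp: staircase_def)
  moreover have "card ?D = k + 1" by (subst card_image) (auto simp: inj_on_def)
  ultimately show ?case using Suc by (simp add: card_Un_disjoint)
qed

lemma card_staircase: assumes "0 \<le> k" shows "2 * int (card (staircase k)) = k * (k + 1)"
proof -
  obtain k' where k: "k = int k'" using assms nonneg_int_cases by blast
  have "int (2 * card (staircase (int k'))) = int (k' * (k' + 1))" by (simp only: card_staircase_nat)
  then show ?thesis unfolding k by (simp add: algebra_simps)
qed

text \<open>
The aligned windows that meet a staircase form a staircase of half the size.
\<close>

lemma sparse_card_staircase:
  assumes "sparse A" "A \<subseteq> staircase k" "0 \<le> k"
  shows "8 * int (card A) \<le> (k + 1) * (k + 3)"
proof -
  define h where "h = (k + 1) div 2"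
  have h: "0 \<le> h" "2 * h \<le> k + 1" using assms(3) unfolding h_def by auto
  have "block ` A \<subseteq> staircase h" using assms(2) unfolding block_def staircase_def h_def by auto
  then have "card (block ` A) \<le> card (staircase h)" by (intro card_mono) auto
  then have "int (card A) \<le> int (card (staircase h))"
    by (simp add: card_image[OF sparse_inj_on_block[OF assms(1)]])
  then have "8 * int (card A) \<le> 4 * (h * (h + 1))" using card_staircase[OF h(1)] by linarith
  also have "\<dots> = (2 * h) * (2 * h + 2)" by (simp add: algebra_simps)
  also have "\<dots> \<le> (k + 1) * (k + 3)" using h by (intro mult_mono) auto
  finally show ?thesis .
qed

lemma sparse_subset: "sparse A \<Longrightarrow> B \<subseteq> A \<Longrightarrow> sparse B"
  unfolding sparse_def by blast

lemma sparse_card_top_right: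
  assumes "sparse A" "\<And>i j. (i, j) \<in> A \<Longrightarrow> 0 \<le> i \<and> j < m \<and> e < j - i" "e < m"
  shows "8 * int (card A) \<le> (m - e) * (m - e + 2)"
proof -
  let ?r = "\<lambda>(i, j). (i, m - 1 - j)"
  have "inj_on ?r A" by (auto simp: inj_on_def)
  then have c: "card (?r ` A) = card A" by (rule card_image)
  have "8 * int (card (?r ` A)) \<le> (m - 1 - e + 1) * (m - 1 - e + 3)"
  proof (rule sparse_card_staircase)
    show "sparse (?r ` A)" unfolding sparse_def
    proof (intro allI impI)
      fix i j i' j' assume a: "(i, j) \<in> ?r ` A" "(i', j') \<in> ?r ` A" and d: "\<bar>i - i'\<bar> \<le> 1" "\<bar>j - j'\<bar> \<le> 1"
      have "(i, m - 1 - j) \<in> A" "(i', m - 1 - j') \<in> A" using a by auto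
      then have "i = i' \<and> m - 1 - j = m - 1 - j'" using assms(1) d unfolding sparse_def by (smt (verit))
      then show "i = i' \<and> j = j'" by simp
    qed
    show "?r ` A \<subseteq> staircase (m - 1 - e)" using assms(2) unfolding staircase_def by fastforce
  qed (use assms(3) in simp)
  then show ?thesis unfolding c by (simp add: algebra_simps)
qed

lemma sparse_swap: "sparse A \<Longrightarrow> sparse (prod.swap ` A)"
  unfolding sparse_def by auto

lemma sparse_card_bottom_left:
  assumes "sparse A" "\<And>i j. (i, j) \<in> A \<Longrightarrow> 0 \<le> j \<and> i < n \<and> e < i - j" "e < n"
  shows "8 * int (card A) \<le> (n - e) * (n - e + 2)"
proof -
  have "8 * int (card (prod.swap ` A)) \<le> (n - e) * (n - e + 2)"
    by (rule sparse_card_top_right[OF sparse_swap[OF assms(1)] _ assms(3)]) (use assms(2) in auto)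
  then show ?thesis by (simp add: card_image)
qed

lemma card_plus_cells_sum: "int (card (plus_cells n m P)) = (\<Sum>i\<in>{0..<n}. \<Sum>j\<in>{0..<m}. of_bool (P i j))"
proof -
  have "plus_cells n m P = (SIGMA i:{0..<n}. {j \<in> {0..<m}. P i j})" by (auto simp: plus_cells_def)
  moreover have "finite {j \<in> {0..<m}. P i j}" for i by (rule finite_subset[of _ "{0..<m}"]) auto
  then have "card (SIGMA i:{0..<n}. {j \<in> {0..<m}. P i j}) = (\<Sum>i\<in>{0..<n}. card {j \<in> {0..<m}. P i j})"
    by (intro card_SigmaI ballI) auto
  ultimately have "card (plus_cells n m P) = (\<Sum>i\<in>{0..<n}. card {j \<in> {0..<m}. P i j})" by (simp only:)
  also have "int \<dots> = (\<Sum>i\<in>{0..<n}. int (card {j \<in> {0..<m}. P i j}))" by simp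
  also have "\<dots> = (\<Sum>i\<in>{0..<n}. \<Sum>j\<in>{0..<m}. of_bool (P i j))"
    by (intro sum.cong refl) (simp add: sum.If_cases of_bool_def Int_def)
  finally show ?thesis .
qed

section \<open>Plus cells are scarce\<close>

text \<open>
A discrepancy less than \<open>- n\<close>, expressed by the number of plus cells.
\<close>

definition plus_scarce :: "int \<Rightarrow> int \<Rightarrow> (int \<Rightarrow> int \<Rightarrow> bool) \<Rightarrow> bool" where
  "plus_scarce n m P \<longleftrightarrow> 2 * int (card (plus_cells n m P)) < n * m - n"

lemma common_window:
  assumes "0 \<le> i" "i < n" "0 \<le> i'" "i' < n" "\<bar>i - i'\<bar> \<le> 1" "2 \<le> (n::int)"
  obtains x where "0 \<le> x" "x + 1 < n" "i \<in> {x, x + 1}" "i' \<in> {x, x + 1}"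
proof
  let ?x = "if min i i' = n - 1 then n - 2 else min i i'"
  show "0 \<le> ?x" "?x + 1 < n" "i \<in> {?x, ?x + 1}" "i' \<in> {?x, ?x + 1}" using assms by (auto simp: min_def)
qed

lemma sparse_plus_cells:
  assumes "2 \<le> n" "2 \<le> m"
    and w: "\<And>x y i j i' j'. 0 \<le> x \<Longrightarrow> x + 1 < n \<Longrightarrow> 0 \<le> y \<Longrightarrow> y + 1 < m \<Longrightarrow>
      i \<in> {x, x + 1} \<Longrightarrow> i' \<in> {x, x + 1} \<Longrightarrow> j \<in> {y, y + 1} \<Longrightarrow> j' \<in> {y, y + 1} \<Longrightarrow>
      (i, j) \<in> A \<Longrightarrow> (i', j') \<in> A \<Longrightarrow> i = i' \<and> j = j'"
    and A: "A \<subseteq> plus_cells n m P"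
  shows "sparse A"
  unfolding sparse_def
proof (intro allI impI)
  fix i j i' j' assume a: "(i, j) \<in> A" "(i', j') \<in> A" and d: "\<bar>i - i'\<bar> \<le> 1" "\<bar>j - j'\<bar> \<le> 1"
  have b: "0 \<le> i" "i < n" "0 \<le> j" "j < m" "0 \<le> i'" "i' < n" "0 \<le> j'" "j' < m"
    using a A unfolding plus_cells_def by auto
  obtain x where "0 \<le> x" "x + 1 < n" "i \<in> {x, x + 1}" "i' \<in> {x, x + 1}"
    using common_window[of i n i'] b d assms by blast
  moreover obtain y where "0 \<le> y" "y + 1 < m" "j \<in> {y, y + 1}" "j' \<in> {y, y + 1}"
    using common_window[of j m j'] b d assms by blast
  ultimately show "i = i' \<and> j = j'" using w a by blast
qed

text \<open>
Twice the number of aligned windows, those at the border included, stays below \<open>n * m - n\<close>; from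
\<open>n = 6\<close> on, the margin makes room for the four additional plus cells of two triangles of size 1.
\<close>

lemma half_area:
  fixes n m :: int
  assumes "n \<le> m" "m \<le> n + 1" "5 \<le> n"
  shows "2 * (((n + 1) div 2) * ((m + 1) div 2)) + (if 6 \<le> n then 8 else 0) < n * m - n"
proof -
  obtain k where k: "n = 2 * k \<or> n = 2 * k + 1"
    using that[of "n div 2"] by linarith
  have k2: "2 * k \<le> k * k" using k assms by (intro mult_right_mono) auto
  have k3: "3 * k \<le> k * k" if "6 \<le> n" using k that by (intro mult_right_mono) auto
  consider "n = 2 * k" "m = 2 * k" | "n = 2 * k" "m = 2 * k + 1"
    | "n = 2 * k + 1" "m = 2 * k + 1" | "n = 2 * k + 1" "m = 2 * k + 2"
    using k assms by linarith
  then show ?thesis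
  proof cases
    case 1
    then have e: "(n + 1) div 2 = k" "(m + 1) div 2 = k" "n * m - n = 4 * (k * k) - 2 * k"
      by (auto simp: algebra_simps)
    have n6: "6 \<le> n" using 1 assms by presburger
    show ?thesis unfolding e if_P[OF n6] using 1 k3[OF n6] n6 by linarith
  next
    case 2
    then have e: "(n + 1) div 2 = k" "(m + 1) div 2 = k + 1" "n * m - n = 4 * (k * k)"
      "2 * (k * (k + 1)) = 2 * (k * k) + 2 * k" by (auto simp: algebra_simps)
    have n6: "6 \<le> n" using 2 assms by presburger
    show ?thesis unfolding e if_P[OF n6] using 2 k3[OF n6] n6 by linarith
  next
    case 3
    then have e: "(n + 1) div 2 = k + 1" "(m + 1) div 2 = k + 1" "n * m - n = 4 * (k * k) + 2 * k"
      "2 * ((k + 1) * (k + 1)) = 2 * (k * k) + 4 * k + 2" by (auto simp: algebra_simps)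
    show ?thesis
    proof (cases "6 \<le> n")
      case True
      then have "3 \<le> k" using 3 by linarith
      then show ?thesis unfolding e if_P[OF True] using k3[OF True] by linarith
    next
      case False
      show ?thesis unfolding e if_not_P[OF False] using 3 k2 assms by linarith
    qed
  next
    case 4
    then have e: "(n + 1) div 2 = k + 1" "(m + 1) div 2 = k + 1" "n * m - n = 4 * (k * k) + 4 * k + 1"
      "2 * ((k + 1) * (k + 1)) = 2 * (k * k) + 4 * k + 2" by (auto simp: algebra_simps)
    show ?thesis
    proof (cases "6 \<le> n")
      case True
      then have "3 \<le> k" using 4 by linarith
      then show ?thesis unfolding e if_P[OF True] using k3[OF True] by linarith
    next
      case False
      show ?thesis unfolding e if_not_P[OF False] using 4 k2 assms by linarith
    qed
  qed
qed

lemma no_triangle_plus_scarce: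
  assumes s: "sea n m P 0 0 0 0" and nm: "n \<le> m" "m \<le> n + 1" "5 \<le> n"
  shows "plus_scarce n m P"
proof -
  have "sparse (plus_cells n m P)"
  proof (rule sparse_plus_cells)
    fix x y i j i' j'
    assume a: "0 \<le> x" "x + 1 < n" "0 \<le> y" "y + 1 < m" "i \<in> {x, x + 1}" "i' \<in> {x, x + 1}"
      "j \<in> {y, y + 1}" "j' \<in> {y, y + 1}" "(i, j) \<in> plus_cells n m P" "(i', j') \<in> plus_cells n m P"
    have "few_pluses P x y" using s a unfolding sea_def outside_def by auto
    from few_plusesD[OF this, of i j i' j'] show "i = i' \<and> j = j'" using a
      unfolding plus_cells_def by auto
  qed (use nm in auto)
  then have c: "int (card (plus_cells n m P)) \<le> ((n + 1) div 2) * ((m + 1) div 2)"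
    using nm by (intro sparse_card_box) (auto simp: plus_cells_def)
  then show ?thesis using half_area[OF nm] unfolding plus_scarce_def by (simp split: if_splits)
qed

text \<open>
A triangle of size 1 has two plus cells more than a sparse set could have in its window.
\<close>

lemma small_triangles_plus_scarce:
  assumes s: "sea n m P 1 0 0 w" and w: "w \<le> 1" and nm: "n \<le> m" "m \<le> n + 1" "6 \<le> n"
  shows "plus_scarce n m P"
proof -
  note B = sea_bounds[OF s nm(1,2)]
  \<comment> \<open>without these cells the triangles, too, have only one plus cell in their window\<close>
  define E where "E = {(0, 1), (1, 0), (n - 1, m - 2), (n - 2, m - 1)}"
  define A where "A = plus_cells n m P - E"
  have "corner_triangle n m P 1 True" using s unfolding sea_def small_triangle_def by auto
  from corner_triangle_out[OF this, of 1 1] have n11: "\<not> P 1 1" using nm by auto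
  have nw: "\<not> P (n - 2) (m - 2)" if "w = 1"
  proof -
    have "corner_triangle n m (flip_cols m (flip_rows n P)) 1 True" using s that
      unfolding sea_def small_triangle_def by auto
    from corner_triangle_out[OF this, of 1 1] show ?thesis using nm
      by (auto simp: flip_cols_def flip_rows_def)
  qed
  have "sparse A"
  proof (rule sparse_plus_cells)
    fix x y i j i' j'
    assume a: "0 \<le> x" "x + 1 < n" "0 \<le> y" "y + 1 < m" "i \<in> {x, x + 1}" "i' \<in> {x, x + 1}"
      "j \<in> {y, y + 1}" "j' \<in> {y, y + 1}" and i: "(i, j) \<in> A" "(i', j') \<in> A"
    have p: "P i j" "P i' j'" "(i, j) \<notin> E" "(i', j') \<notin> E" using i unfolding A_def plus_cells_def by auto
    consider "outside n m 1 0 0 w x y" | "x = 0" "y = 0" | "w = 1" "x = n - 2" "y = m - 2"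
    proof -
      have "outside n m 1 0 0 w x y \<or> (x = 0 \<and> y = 0) \<or> (w = 1 \<and> x = n - 2 \<and> y = m - 2)"
        using a(1-4) w B(4) nm unfolding outside_def by auto
      then show ?thesis using that by blast
    qed
    then show "i = i' \<and> j = j'"
    proof cases
      case 1
      then have "few_pluses P x y" using s unfolding sea_def by auto
      from few_plusesD[OF this, of i j i' j'] show ?thesis using a p by auto
    next
      case 2
      then have "(i = 0 \<and> j = 0) \<and> (i' = 0 \<and> j' = 0)" using a p n11 unfolding E_def by auto
      then show ?thesis by simp
    next
      case 3
      then have "(i = n - 1 \<and> j = m - 1) \<and> (i' = n - 1 \<and> j' = m - 1)" using a p nw
        unfolding E_def by auto
      then show ?thesis by simp
    qed
  qed (use nm in \<open>auto simp: A_def\<close>)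
  then have "int (card A) \<le> ((n + 1) div 2) * ((m + 1) div 2)"
    using nm by (intro sparse_card_box) (auto simp: A_def plus_cells_def)
  moreover have "card (plus_cells n m P) \<le> card A + card E"
  proof -
    have "card (plus_cells n m P) \<le> card (A \<union> E)" by (intro card_mono) (auto simp: A_def E_def)
    also have "\<dots> \<le> card A + card E" by (rule card_Un_le)
    finally show ?thesis .
  qed
  moreover have "card E \<le> 4" unfolding E_def by (auto intro!: card_insert_le_m1)
  ultimately have c: "int (card (plus_cells n m P)) \<le> ((n + 1) div 2) * ((m + 1) div 2) + 4" by linarith
  then show ?thesis using half_area[OF nm(1,2)] nm(3) unfolding plus_scarce_def by simp
qed

lemma few_pluses_sum:
  assumes "few_pluses P i j"
  shows "of_bool (P i j) + of_bool (P i (j + 1)) + of_bool (P (i + 1) j) + of_bool (P (i + 1) (j + 1))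
    \<le> (1::int)"
  using assms unfolding few_pluses_iff by auto

text \<open>
For five rows the margin of \<open>half_area\<close> does not suffice. The bound comes from a covering by the
\<open>2 \<times> 3\<close> rectangle at the first triangle, pieces of the third row, and windows in the other rows that
are not aligned with the first corner.
\<close>

lemma small_triangles_plus_scarce_five:
  assumes s: "sea 5 m P 1 0 0 w" and w: "w = 0 \<or> w = 1" and m: "m = 5 \<or> m = 6"
  shows "plus_scarce 5 m P"
proof -
  define b where "b i j = (of_bool (P i j) :: int)" for i j
  have b1: "b i j \<le> 1" for i j by (simp add: b_def)
  have b0: "0 \<le> b i j" for i j by (simp add: b_def)
  have sol: "corner_triangle 5 m P 1 True" using s unfolding sea_def small_triangle_def by auto
  have z: "b 0 2 = 0" "b 1 1 = 0" "b 2 0 = 0" "b 1 2 = 0" "b 2 1 = 0"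
    using m corner_triangle_out[OF sol, of 0 2] corner_triangle_out[OF sol, of 1 1]
      corner_triangle_out[OF sol, of 2 0]
      corner_triangle_out2[OF sol, of 1 2] corner_triangle_out2[OF sol, of 2 1] unfolding b_def by auto
  have W: "b i j + b i (j + 1) + b (i + 1) j + b (i + 1) (j + 1) \<le> 1" if "outside 5 m 1 0 0 w i j" for
    i j
    unfolding b_def by (rule few_pluses_sum) (use s that in \<open>auto simp: sea_def\<close>)
  have five: "{0..<5::int} = {0, 1, 2, 3, 4}" and six: "{0..<6::int} = {0, 1, 2, 3, 4, 5}" by auto
  have c: "int (card (plus_cells 5 m P)) = (\<Sum>i\<in>{0..<5}. \<Sum>j\<in>{0..<m}. b i j)" (is "_ = ?S")
    unfolding card_plus_cells_sum b_def ..
  have W1: "b 0 3 + b 0 4 + b 1 3 + b 1 4 \<le> 1" "b 2 2 + b 2 3 + b 3 2 + b 3 3 \<le> 1"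
    "b 3 0 + b 3 1 + b 4 0 + b 4 1 \<le> 1"
    using W[of 0 3] W[of 2 2] W[of 3 0] m w unfolding outside_def by auto
  have z1: "b (5 - 1 - i) (m - 1 - j) = 0" if "w = 1" "(i, j) \<in> {(0, 2), (1, 1), (2, 0), (1, 2)}" for i j
  proof -
    have so: "corner_triangle 5 m (flip_cols m (flip_rows 5 P)) 1 True" using s that
      unfolding sea_def small_triangle_def by auto
    show ?thesis
      using that m corner_triangle_out[OF so, of i j] corner_triangle_out2[OF so, of i j]
        unfolding b_def flip_cols_def flip_rows_def by auto
  qed
  show ?thesis
  proof (cases "m = 5")
    case True
    have "?S \<le> 9"
    proof (cases "w = 1")
      case True
      have "b 4 2 = 0" "b 3 3 = 0" "b 2 4 = 0" "b 3 2 = 0"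
        using z1[of 0 2] z1[of 1 1] z1[of 2 0] z1[of 1 2] True \<open>m = 5\<close> by auto
      then show ?thesis
        using W1 z b1[of 0 0] b1[of 0 1] b1[of 1 0] b1[of 3 4] b1[of 4 3] b1[of 4 4]
        unfolding \<open>m = 5\<close> five by simp
    next
      case False
      have "b 3 2 + b 3 3 + b 4 2 + b 4 3 \<le> 1" "b 3 3 + b 3 4 + b 4 3 + b 4 4 \<le> 1"
        using W[of 3 2] W[of 3 3] False w \<open>m = 5\<close> unfolding outside_def by auto
      then show ?thesis
        using W1 z b1[of 0 0] b1[of 0 1] b1[of 1 0] b1[of 2 4] b0[of 3 2] b0[of 3 3] b0[of 4 3]
        unfolding \<open>m = 5\<close> five by simp
    qed
    then show ?thesis unfolding plus_scarce_def c using True by simp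
  next
    case False
    then have m6: "m = 6" using m by simp
    have W2: "b 0 4 + b 0 5 + b 1 4 + b 1 5 \<le> 1" "b 2 4 + b 2 5 + b 3 4 + b 3 5 \<le> 1"
      "b 3 2 + b 3 3 + b 4 2 + b 4 3 \<le> 1"
      using W[of 0 4] W[of 2 4] W[of 3 2] m6 w unfolding outside_def by auto
    have "?S \<le> 12"
      using W1 W2 z b1[of 0 0] b1[of 0 1] b1[of 1 0] b1[of 4 4] b1[of 4 5]
        b0[of 0 4] b0[of 1 4] b0[of 3 2] b0[of 3 3]
      unfolding m6 five six by simp
    then show ?thesis unfolding plus_scarce_def c using m6 by simp
  qed
qed

text \<open>
The lemmas on the strip, for both sides of the diagonal of the matrix. They do not reach plus cells
on the very edge of the strip that are far from the triangle and, for \<open>t = 2\<close> and \<open>m = n + 1\<close>, the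
last cell of the matrix.
\<close>

lemma sea_strip:
  assumes s: "sea n m P t 0 0 0" and t: "2 \<le> t" and nm: "n \<le> m" "m \<le> n + 1" "5 \<le> n"
    and p: "P i j" and b: "0 \<le> i" "i < n" "0 \<le> j" "j < m" "t < i + j"
  shows "(t \<le> j - i \<and> (j - i = t \<longrightarrow> 2 * t \<le> i)) \<or> (t \<le> i - j \<and> (i - j = t \<longrightarrow> 2 * t \<le> j)) \<or>
    (t = 2 \<and> m = n + 1 \<and> i = n - 1 \<and> j = n)"
proof (rule ccontr)
  assume c: "\<not> ?thesis"
  note B = sea_bounds(5)[OF s nm]
  have f: "no_zero_square n m P" and so: "corner_triangle n m P t True" using s t
    unfolding sea_def small_triangle_def by auto
  have tb: "t \<le> n - 2" "t \<le> m - 2" using B nm by auto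
  have few_pluses: "few_pluses P i j" if "0 \<le> i" "i + 1 < n" "0 \<le> j" "j + 1 < m" "t \<le> i + j" for i j
    using s that unfolding sea_def outside_def by auto
  have few_pluses': "few_pluses (transposed P) i j" if "0 \<le> i" "i + 1 < m" "0 \<le> j" "j + 1 < n"
    "t \<le> i + j" for i j
    unfolding few_pluses_transposed using that by (intro few_pluses) auto
  note [simp] = no_zero_square_transposed[OF f] corner_triangle_transposed[OF so]
  have p': "transposed P j i" using p by (simp add: transposed_def)
  consider "j = i" | "i < j" "j - i \<le> t" | "j < i" "i - j \<le> t" using c by linarith
  then show False
  proof cases
    case 1
    then show False using strip_inner[OF f so t tb few_pluses, of i j] p b t by auto
  next
    case 2
    then consider "j - i = t" "i < 2 * t" | "j - i \<le> t - 1" using c by linarith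
    then show False
    proof cases
      case 1
      then show False using strip_edge[OF f so t tb few_pluses, of i j] p b t nm by auto
    next
      case 2
      show False
      proof (cases "i + 1 < n")
        case True
        then show False using strip_outer[OF f so t tb few_pluses, of i j] p b \<open>i < j\<close> 2 by auto
      next
        case False
        then have "i = n - 1" "j = n" "m = n + 1" using b nm \<open>i < j\<close> by auto
        then show False using c 2 strip_inner[OF f so t tb few_pluses, of i j] p b t by auto
      qed
    qed
  next
    case 3
    then consider "i - j = t" "j < 2 * t" | "i - j \<le> t - 1" using c by linarith
    then show False
    proof cases
      case 1
      then show False
        using strip_edge[OF no_zero_square_transposed[OF f] corner_triangle_transposed[OF so] t tb(2,1)
        few_pluses', of j i] p' b t nm by auto
    next
      case 2
      then show False
        using strip_outer[OF no_zero_square_transposed[OF f] corner_triangle_transposed[OF so] t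
        tb(2,1) few_pluses', of j i] p' b nm \<open>j < i\<close> by auto
    qed
  qed
qed

text \<open>
The inequality behind the count for a single triangle. Here \<open>e\<close> is the half width of the strip without
plus cells, \<open>B\<close> is the number of plus cells beyond the triangle, and \<open>x\<close> counts the exceptional last
cell. If the strip has to be taken narrower, the triangle is small compared with the matrix.
\<close>

lemma big_triangle_bound:
  fixes n m t e B x :: int
  assumes nm: "m = n \<or> m = n + 1" "5 \<le> n" and t: "2 \<le> t" "t \<le> n - 2" "\<not> (m = n \<and> t = n - 2)"
    and e: "e = t \<or> (e = t - 1 \<and> 2 * t \<le> m - t - 1)"
    and x: "x = 0 \<or> (x = 1 \<and> t = 2 \<and> m = n + 1)"
    and B: "8 * B \<le> (m - e) * (m - e + 2) + (n - e) * (n - e + 2) + 8 * x"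
  shows "(t + 1) * (t + 2) + 2 * B < n * m - n"
proof -
  define a where "a = t + 1"
  define k where "k = n - t - 1"
  have nk: "n = a + k" "t = a - 1" and a3: "3 \<le> a" and k1: "1 \<le> k" using t unfolding a_def k_def by auto
  show ?thesis
  proof (cases "m = n")
    case m: True
    have k2: "2 \<le> k" using t(3) m k1 unfolding k_def by linarith
    have "0 \<le> (a - 3) * (k - 1)" using a3 k1 by simp
    then have P: "3 * k + a \<le> a * k + 3" by (simp add: algebra_simps)
    have G: "n * m - n - (t + 1) * (t + 2) = 2 * (a * k) + k * k - 2 * a - k"
      unfolding m nk by (simp add: algebra_simps)
    from e show ?thesis
    proof
      assume "e = t"
      then have "8 * B \<le> 2 * (k * k) + 8 * k + 6" using B x m unfolding nk by (auto simp: algebra_simps)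
      moreover have "2 * k \<le> k * k" using k2 by (intro mult_right_mono) auto
      ultimately show ?thesis using G P k2 by linarith
    next
      assume e: "e = t - 1 \<and> 2 * t \<le> m - t - 1"
      then have "2 * a \<le> k + 2" unfolding m nk by simp
      then have k4: "4 \<le> k" using a3 by linarith
      have "8 * B \<le> 2 * (k * k) + 12 * k + 16" using B x m e unfolding nk by (auto simp: algebra_simps)
      moreover have "4 * k \<le> k * k" using k4 by (intro mult_right_mono) auto
      ultimately show ?thesis using G P k4 by linarith
    qed
  next
    case False
    then have m: "m = n + 1" using nm by simp
    have "0 \<le> (a - 3) * (2 * k - 1)" using a3 k1 by simp
    then have P: "6 * k + a \<le> 2 * (a * k) + 3" by (simp add: algebra_simps)
    have G: "n * m - n - (t + 1) * (t + 2) = 2 * (a * k) + k * k - a"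
      unfolding m nk by (simp add: algebra_simps)
    from e show ?thesis
    proof
      assume "e = t"
      then have B': "8 * B \<le> 2 * (k * k) + 10 * k + 11 + 8 * x" using B m unfolding nk
        by (auto simp: algebra_simps)
      show ?thesis
      proof (cases "k = 1")
        case True
        then have "x = 0" "4 \<le> a" using x nk nm by auto
        then have "2 * B \<le> 4" using B' True by simp
        then show ?thesis using G True \<open>4 \<le> a\<close> by simp
      next
        case False
        then have k2: "2 \<le> k" using k1 by simp
        moreover have "2 * k \<le> k * k" using k2 by (intro mult_right_mono) auto
        moreover have "x \<le> 1" using x by auto
        ultimately show ?thesis using G P B' by linarith
      qed
    next
      assume e: "e = t - 1 \<and> 2 * t \<le> m - t - 1"
      then have "2 * a \<le> k + 3" unfolding m nk by simp
      then have k3: "3 \<le> k" using a3 by linarith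
      have "8 * B \<le> 2 * (k * k) + 14 * k + 23 + 8 * x" using B m e unfolding nk
        by (auto simp: algebra_simps)
      moreover have "3 * k \<le> k * k" using k3 by (intro mult_right_mono) auto
      moreover have "x \<le> 1" using x by auto
      ultimately show ?thesis using G P k3 by linarith
    qed
  qed
qed

text \<open>
The plus cells beyond the triangle lie in two triangles at the adjacent corners. These are empty if
\<open>t\<close> has its largest possible value in a square matrix.
\<close>

lemma big_triangle_split_or_plus_scarce:
  assumes s: "sea n m P t 0 0 0" and t: "2 \<le> t" and nm: "n \<le> m" "m \<le> n + 1" "5 \<le> n"
  shows "diagonal_split n m P \<or> plus_scarce n m P"
proof -
  have tn: "t \<le> n - 2" using sea_bounds(5)[OF s nm] .
  have f: "no_zero_square n m P" and so: "corner_triangle n m P t True" using s t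
    unfolding sea_def small_triangle_def by auto
  have tb: "t \<le> n - 2" "t \<le> m - 2" using tn nm by auto
  have few_pluses: "few_pluses P i j" if "0 \<le> i" "i + 1 < n" "0 \<le> j" "j + 1 < m" "t \<le> i + j" for i j
    using s that unfolding sea_def outside_def by auto
  \<comment> \<open>cells on the edge of the strip have to be counted only if their rows or columns reach \<open>2 * t\<close>\<close>
  define e where "e = (if 2 * t \<le> m - t - 1 then t - 1 else t)"
  define B where "B = {(i, j) \<in> plus_cells n m P. t < i + j}"
  define X where "X = (if t = 2 \<and> m = n + 1 then {(n - 1, n)} else {})"
  define U where "U = {(i, j) \<in> B. e < j - i}"
  define L where "L = {(i, j) \<in> B. e < i - j}"
  have finB: "finite B" unfolding B_def by (rule finite_subset[OF _ finite_plus_cells[of n m P]]) auto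
  have strip: "(i, j) \<in> U \<union> L \<union> X" if "(i, j) \<in> B" for i j
  proof -
    have b: "P i j" "0 \<le> i" "i < n" "0 \<le> j" "j < m" "t < i + j" using that
      unfolding B_def plus_cells_def by auto
    from sea_strip[OF s t nm b] show ?thesis
      using that b nm unfolding U_def L_def X_def e_def by auto
  qed
  have spB: "sparse B" unfolding sparse_def
  proof (intro allI impI, rule ccontr)
    fix i j i' j' assume a: "(i, j) \<in> B" "(i', j') \<in> B" "\<bar>i - i'\<bar> \<le> 1" "\<bar>j - j'\<bar> \<le> 1"
      "\<not> (i = i' \<and> j = j')"
    have b: "P i j" "0 \<le> i" "i < n" "0 \<le> j" "j < m" "t < i + j" "P i' j'" "0 \<le> i'" "i' < n" "0 \<le> j'"
      "j' < m"
      using a unfolding B_def plus_cells_def by auto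
    have "i + j \<noteq> t + 1" using corner_triangle_out[OF so, of i j] b by auto
    then have "\<not> P i' j'" using a b by (intro isolated[OF f so t tb few_pluses b(1)]) auto
    then show False using b by simp
  qed
  show ?thesis
  proof (cases "m = n \<and> t = n - 2")
    case True
    have "B = {}"
    proof (rule ccontr)
      assume "B \<noteq> {}"
      then obtain i j where ij: "(i, j) \<in> B" by (metis ex_in_conv surj_pair)
      have b: "P i j" "0 \<le> i" "i < n" "0 \<le> j" "j < m" "t < i + j" using ij
        unfolding B_def plus_cells_def by auto
      have "i + j = t + 1" using strip[OF ij] b True nm t unfolding U_def L_def X_def e_def
        by (auto split: if_splits)
      then show False using corner_triangle_out[OF so, of i j] b by auto
    qed
    moreover have "(i, j) \<in> B" if "0 \<le> i" "i < n" "0 \<le> j" "j < m" "P i j" "\<not> i + j \<le> t" for i j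
      using that unfolding B_def plus_cells_def by auto
    ultimately have "P i j = ((i + j \<le> t) = True)" if "0 \<le> i" "i < n" "0 \<le> j" "j < m" for i j
      using that corner_triangle_in[OF so, of i j] by auto
    then show ?thesis unfolding diagonal_split_def by blast
  next
    case False
    have en: "e < n" "e < m" using tn nm unfolding e_def by auto
    have "8 * int (card U) \<le> (m - e) * (m - e + 2)"
      by (rule sparse_card_top_right[OF sparse_subset[OF spB]]) (use en in \<open>auto simp: U_def B_def
        plus_cells_def\<close>)
    moreover have "8 * int (card L) \<le> (n - e) * (n - e + 2)"
      by (rule sparse_card_bottom_left[OF sparse_subset[OF spB]]) (use en in \<open>auto simp: L_def B_def
        plus_cells_def\<close>)
    moreover have "card B \<le> card U + card L + card X"
    proof -
      have fin: "finite (U \<union> L \<union> X)" using finB unfolding U_def L_def X_def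
        by (auto intro: finite_subset[of _ B])
      have "B \<subseteq> U \<union> L \<union> X" using strip by auto
      then have "card B \<le> card (U \<union> L \<union> X)" using fin by (rule card_mono[rotated])
      also have "\<dots> \<le> card (U \<union> L) + card X" by (rule card_Un_le)
      also have "\<dots> \<le> card U + card L + card X" using card_Un_le[of U L] by simp
      finally show ?thesis .
    qed
    ultimately have B: "8 * int (card B) \<le> (m - e) * (m - e + 2) + (n - e) * (n - e + 2) + 8 * int
      (card X)"
      by linarith
    have "(t + 1) * (t + 2) + 2 * int (card B) < n * m - n"
    proof (rule big_triangle_bound[OF _ nm(3) t tn False _ _ B])
      show "m = n \<or> m = n + 1" using nm by linarith
      show "e = t \<or> e = t - 1 \<and> 2 * t \<le> m - t - 1" unfolding e_def by simp
      show "int (card X) = 0 \<or> int (card X) = 1 \<and> t = 2 \<and> m = n + 1" unfolding X_def by simp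
    qed
    moreover have "card (plus_cells n m P) \<le> card (staircase (t + 1)) + card B"
    proof -
      have "plus_cells n m P \<subseteq> staircase (t + 1) \<union> B"
        unfolding B_def staircase_def plus_cells_def by auto
      then have "card (plus_cells n m P) \<le> card (staircase (t + 1) \<union> B)" using finB
        by (intro card_mono) auto
      also have "\<dots> \<le> card (staircase (t + 1)) + card B" by (rule card_Un_le)
      finally show ?thesis .
    qed
    moreover have "2 * int (card (staircase (t + 1))) = (t + 1) * (t + 2)"
      using card_staircase[of "t + 1"] t by (simp add: algebra_simps)
    ultimately have "plus_scarce n m P" unfolding plus_scarce_def by linarith
    then show ?thesis ..
  qed
qed

text \<open>
By the exclusion results only three configurations remain: no triangle, triangles of size 1 at one
corner or at two opposite corners, and one larger triangle.
\<close>

lemma sea_split_or_plus_scarce_if_max: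
  assumes s: "sea n m P t u v w" and mx: "u \<le> t" "v \<le> t" "w \<le> t" and nm: "n \<le> m" "m \<le> n + 1" "5 \<le> n"
  shows "diagonal_split n m P \<or> plus_scarce n m P"
proof -
  note B = sea_bounds(1-4)[OF s nm]
  show ?thesis
  proof (cases "t = 0")
    case True
    then have "u = 0" "v = 0" "w = 0" using B mx by auto
    then show ?thesis using no_triangle_plus_scarce s nm True by blast
  next
    case False
    then have t: "1 \<le> t" using B by simp
    have v: "v = 0" using no_vertical_neighbour[OF s nm t mx(1,3)] B by (cases "1 \<le> v") auto
    have u: "u = 0" using no_horizontal_neighbour[OF s nm t mx] B by (cases "1 \<le> u") auto
    note s = s[unfolded u v]
    show ?thesis
    proof (cases "t = 1")
      case True
      then have w: "w = 0 \<or> w = 1" using B mx by auto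
      show ?thesis
      proof (cases "6 \<le> n")
        case n6: True
        have "plus_scarce n m P" using small_triangles_plus_scarce[of n m P w] s w nm n6 True by auto
        then show ?thesis ..
      next
        case False
        then have "n = 5" "m = 5 \<or> m = 6" using nm by auto
        then have "plus_scarce n m P" using small_triangles_plus_scarce_five[of m P w] s w True by auto
        then show ?thesis ..
      qed
    next
      case False
      then have t2: "2 \<le> t" using t by simp
      have "w = 0" using no_opposite_island[OF s nm t2 mx(3)] B by (cases "1 \<le> w") auto
      then show ?thesis using big_triangle_split_or_plus_scarce[of n m P t] s t2 nm by blast
    qed
  qed
qed

lemma card_plus_cells_flip_cols: "card (plus_cells n m (flip_cols m P)) = card (plus_cells n m P)"
proof -
  have "bij_betw (\<lambda>(i, j). (i, m - 1 - j)) (plus_cells n m (flip_cols m P)) (plus_cells n m P)"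
    by (rule bij_betw_byWitness[where f' = "\<lambda>(i, j). (i, m - 1 - j)"]) (auto simp: plus_cells_def
      flip_cols_def)
  then show ?thesis by (rule bij_betw_same_card)
qed

lemma card_plus_cells_flip_rows: "card (plus_cells n m (flip_rows n P)) = card (plus_cells n m P)"
proof -
  have "bij_betw (\<lambda>(i, j). (n - 1 - i, j)) (plus_cells n m (flip_rows n P)) (plus_cells n m P)"
    by (rule bij_betw_byWitness[where f' = "\<lambda>(i, j). (n - 1 - i, j)"]) (auto simp: plus_cells_def
      flip_rows_def)
  then show ?thesis by (rule bij_betw_same_card)
qed

lemma card_plus_cells_negated:
  assumes "0 \<le> n" "0 \<le> m"
  shows "int (card (plus_cells n m (negated P))) = n * m - int (card (plus_cells n m P))"
proof -
  have "plus_cells n m (negated P) \<union> plus_cells n m P = {0..<n} \<times> {0..<m}"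
    by (auto simp: plus_cells_def negated_def)
  moreover have "plus_cells n m (negated P) \<inter> plus_cells n m P = {}"
    by (auto simp: plus_cells_def negated_def)
  ultimately have "card (plus_cells n m (negated P)) + card (plus_cells n m P) = card ({0..<n} \<times>
    {0..<m})"
    by (metis card_Un_disjoint finite_plus_cells)
  then have "int (card (plus_cells n m (negated P)) + card (plus_cells n m P)) = n * m"
    using assms by (simp add: card_cartesian_product)
  then show ?thesis by simp
qed

text \<open>
The two reflections differ by a half turn, which exchanges the two sides of a diagonal.
\<close>

lemma diagonal_split_flip_rows: "diagonal_split n m (flip_rows n P) \<Longrightarrow> diagonal_split n m (flip_cols m P)"
proof -
  assume "diagonal_split n m (flip_rows n P)"
  then obtain t c where a: "\<And>i j. 0 \<le> i \<Longrightarrow> i < n \<Longrightarrow> 0 \<le> j \<Longrightarrow> j < m \<Longrightarrow> flip_rows n P i j = ((i + j \<le> t) = c)"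
    unfolding diagonal_split_def by blast
  have "flip_cols m P i j = ((i + j \<le> n + m - 3 - t) = (\<not> c))" if "0 \<le> i" "i < n" "0 \<le> j" "j < m" for i j
    using a[of "n - 1 - i" "m - 1 - j"] that by (auto simp: flip_rows_def flip_cols_def)
  then show ?thesis unfolding diagonal_split_def by blast
qed

lemma diagonal_split_negated: "diagonal_split n m (negated P) \<Longrightarrow> diagonal_split n m P"
proof -
  assume "diagonal_split n m (negated P)"
  then obtain t c where a: "\<And>i j. 0 \<le> i \<Longrightarrow> i < n \<Longrightarrow> 0 \<le> j \<Longrightarrow> j < m \<Longrightarrow> negated P i j = ((i + j \<le> t) = c)"
    unfolding diagonal_split_def by blast
  have "P i j = ((i + j \<le> t) = (\<not> c))" if "0 \<le> i" "i < n" "0 \<le> j" "j < m" for i j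
    using a[of i j] that by (auto simp: negated_def)
  then show ?thesis unfolding diagonal_split_def by blast
qed

lemma sea_split_or_plus_scarce:
  assumes s: "sea n m P t u v w" and nm: "n \<le> m" "m \<le> n + 1" "5 \<le> n"
  shows "diagonal_split n m P \<or> diagonal_split n m (flip_cols m P) \<or> plus_scarce n m P"
proof -
  consider "u \<le> t" "v \<le> t" "w \<le> t" | "t \<le> u" "w \<le> u" "v \<le> u" | "w \<le> v" "t \<le> v" "u \<le> v" | "v \<le> w"
    "u \<le> w" "t \<le> w"
    by linarith
  then show ?thesis
  proof cases
    case 1 then show ?thesis using sea_split_or_plus_scarce_if_max[OF s _ _ _ nm] by blast
  next
    case 2
    then show ?thesis using sea_split_or_plus_scarce_if_max[OF sea_flip_cols[OF s] _ _ _ nm]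
      by (auto simp: plus_scarce_def card_plus_cells_flip_cols)
  next
    case 3
    then show ?thesis
      using sea_split_or_plus_scarce_if_max[OF sea_flip_rows[OF s] _ _ _ nm] diagonal_split_flip_rows
      by (auto simp: plus_scarce_def card_plus_cells_flip_rows)
  next
    case 4
    then have "diagonal_split n m (flip_cols m (flip_rows n P)) \<or>
      plus_scarce n m (flip_cols m (flip_rows n P))"
      using sea_split_or_plus_scarce_if_max[OF sea_flip_cols[OF sea_flip_rows[OF s]] _ _ _ nm] by blast
    then show ?thesis using diagonal_split_flip_rows[of n m "flip_cols m P"]
      by (auto simp: plus_scarce_def card_plus_cells_flip_rows card_plus_cells_flip_cols)
  qed
qed

text \<open>
If the majority of the sea is plus, the bound applies to the pattern with all signs exchanged.
\<close>

theorem split_or_unbalanced: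
  assumes f: "no_zero_square n m P" and nm: "n \<le> m" "m \<le> n + 1" "5 \<le> n"
  shows "diagonal_split n m P \<or> diagonal_split n m (flip_cols m P) \<or>
    n < \<bar>2 * int (card (plus_cells n m P)) - n * m\<bar>"
proof (rule ccontr)
  assume c: "\<not> ?thesis"
  then obtain t u v w where "sea n m P t u v w \<or> sea n m (negated P) t u v w"
    using sea_exists[OF f nm] by blast
  then show False
  proof
    assume "sea n m P t u v w"
    from sea_split_or_plus_scarce[OF this nm] show False using c unfolding plus_scarce_def by auto
  next
    assume "sea n m (negated P) t u v w"
    from sea_split_or_plus_scarce[OF this nm] have "plus_scarce n m (negated P)"
      using c diagonal_split_negated[of n m P] diagonal_split_negated[of n m "flip_cols m P"]
        by (auto simp: flip_cols_negated)
    moreover have "int (card (plus_cells n m (negated P))) = n * m - int (card (plus_cells n m P))"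
      using nm by (intro card_plus_cells_negated) auto
    ultimately show False using c unfolding plus_scarce_def
      by (auto simp: algebra_simps not_less abs_le_iff)
  qed
qed

section \<open>From patterns to matrices\<close>

text \<open>
Values of \<open>t\<close> for which the pattern is constant are cut off to the permitted range.
\<close>

lemma t_split_of_diagonal:
  assumes bin: "\<And>i j. i < dim_row N \<Longrightarrow> j < dim_col N \<Longrightarrow> N $$ (i, j) = 1 \<or> N $$ (i, j) = - 1"
    and d: "\<And>i j. i < dim_row N \<Longrightarrow> j < dim_col N \<Longrightarrow> N $$ (i, j) = - 1 \<longleftrightarrow> int i + int j \<le> t"
    and ne: "0 < dim_row N"
  shows "\<exists>s. t_split s N"
proof -
  define s where "s = nat (min (t + 1) (int (dim_row N) + int (dim_col N) - 1))"
  have "N $$ (i, j) = (if (i + 1) + (j + 1) \<le> s + 1 then - 1 else 1)" if "i < dim_row N"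
    "j < dim_col N" for i j
  proof -
    have "(i + 1) + (j + 1) \<le> s + 1 \<longleftrightarrow> int i + int j \<le> t" using that unfolding s_def by auto
    then show ?thesis using bin[OF that] d[OF that] by auto
  qed
  moreover have "s < dim_row N + dim_col N" using ne unfolding s_def by auto
  ultimately show ?thesis unfolding t_split_def by blast
qed

lemma sum_double_minus_one:
  fixes g :: "nat \<Rightarrow> nat \<Rightarrow> int"
  shows "(\<Sum>i<n. \<Sum>j<m. 2 * g i j - 1) = 2 * (\<Sum>i<n. \<Sum>j<m. g i j) - int n * int m"
  by (simp add: sum_subtractf sum_distrib_left)

theorem theorem6:
  fixes n m :: nat and M :: "int mat"
  assumes "n \<ge> 5"
    and "m \<in> {n, n + 1}"
    and "M \<in> carrier_mat n m"
    and "binary_mat M"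
    and "\<not> split_mat M"
    and "\<bar>disc M\<bar> \<le> int n"
  shows "has_zero_sum_square M"
proof (rule ccontr)
  assume no: "\<not> has_zero_sum_square M"
  have dim [simp]: "dim_row M = n" "dim_col M = m" using assms(3) by auto
  have bin: "M $$ (i, j) = 1 \<or> M $$ (i, j) = - 1" if "i < n" "j < m" for i j
    using assms(4) that elements_matI[OF assms(3) that refl] unfolding binary_mat_def by auto
  define P where "P i j = (M $$ (nat i, nat j) = 1)" for i j
  have P: "P (int i) (int j) = (M $$ (i, j) = 1)" for i j by (simp add: P_def)
  have "no_zero_square (int n) (int m) P" unfolding no_zero_square_def
  proof (intro allI impI)
    fix i j s :: int assume a: "0 \<le> i" "0 \<le> j" "0 < s" "i + s < int n" "j + s < int m"
    have sq: "is_square M (nat i) (nat j) (nat s)" using a unfolding is_square_def by auto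
    then have nz: "square_sum M (nat i) (nat j) (nat s) \<noteq> 0" using no
      unfolding has_zero_sum_square_def by blast
    have lt: "nat i + nat s < n" "nat j + nat s < m" "nat i < n" "nat j < m" using a by auto
    have e: "nat (i + s) = nat i + nat s" "nat (j + s) = nat j + nat s" using a by auto
    show "\<not> balanced (P i j) (P i (j + s)) (P (i + s) j) (P (i + s) (j + s))"
      using nz bin[OF lt(3,4)] bin[OF lt(3,2)] bin[OF lt(1,4)] bin[OF lt(1,2)]
      unfolding P_def e square_sum_def balanced_def by auto
  qed
  then consider "diagonal_split (int n) (int m) P" | "diagonal_split (int n) (int m) (flip_cols (int m)
    P)"
    | "int n < \<bar>2 * int (card (plus_cells (int n) (int m) P)) - int n * int m\<bar>"
    using split_or_unbalanced[of "int n" "int m" P] assms(1,2) by fastforce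
  then show False
  proof cases
    case 1
    then obtain t c where s: "\<And>i j. 0 \<le> i \<Longrightarrow> i < int n \<Longrightarrow> 0 \<le> j \<Longrightarrow> j < int m \<Longrightarrow> P i j = ((i + j \<le> t) = c)"
      unfolding diagonal_split_def by blast
    have s': "(M $$ (i, j) = 1) = ((int i + int j \<le> t) = c)" if "i < n" "j < m" for i j
      using s[of "int i" "int j"] that P by simp
    show False
    proof (cases c)
      case True
      have "(- M) $$ (i, j) = - 1 \<longleftrightarrow> int i + int j \<le> t" "(- M) $$ (i, j) = 1 \<or> (- M) $$ (i, j) = - 1"
        if "i < n" "j < m" for i j
        using s'[OF that] bin[OF that] that True by auto
      then have "\<exists>s. t_split s (- M)"
        by (intro t_split_of_diagonal[of _ t]) (use assms(1) in auto)
      then show False using assms(5) unfolding split_mat_def by blast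
    next
      case False
      have "M $$ (i, j) = - 1 \<longleftrightarrow> int i + int j \<le> t" if "i < n" "j < m" for i j
        using s'[OF that] bin[OF that] False by auto
      then have "\<exists>s. t_split s M"
        by (intro t_split_of_diagonal[of _ t]) (use bin assms(1) in auto)
      then show False using assms(5) unfolding split_mat_def by blast
    qed
  next
    case 2
    then obtain t c where s: "\<And>i j. 0 \<le> i \<Longrightarrow> i < int n \<Longrightarrow> 0 \<le> j \<Longrightarrow> j < int m \<Longrightarrow>
      flip_cols (int m) P i j = ((i + j \<le> t) = c)"
      unfolding diagonal_split_def by blast
    show False
    proof (cases c)
      case False
      have "\<exists>s. t_split s (horizontal_reflection M)"
      proof (rule t_split_of_diagonal[of _ t])
        fix i j assume a: "i < dim_row (horizontal_reflection M)" "j < dim_col (horizontal_reflection M)"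
        then have ij: "i < n" "j < m" "m - 1 - j < m" by (auto simp: horizontal_reflection_def)
        have h: "horizontal_reflection M $$ (i, j) = M $$ (i, m - 1 - j)"
          using ij by (simp add: horizontal_reflection_def)
        show "horizontal_reflection M $$ (i, j) = 1 \<or> horizontal_reflection M $$ (i, j) = - 1"
          unfolding h by (rule bin[OF ij(1,3)])
        have e: "int m - 1 - int j = int (m - 1 - j)" using ij by simp
        have "flip_cols (int m) P (int i) (int j) = (M $$ (i, m - 1 - j) = 1)"
          unfolding flip_cols_def e P ..
        then have "(M $$ (i, m - 1 - j) = 1) = (\<not> int i + int j \<le> t)"
          using s[of "int i" "int j"] ij False by simp
        then show "horizontal_reflection M $$ (i, j) = - 1 \<longleftrightarrow> int i + int j \<le> t"
          unfolding h using bin[OF ij(1,3)] by auto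
      qed (use assms(1) in \<open>auto simp: horizontal_reflection_def\<close>)
      then show False using assms(5) unfolding split_mat_def by blast
    next
      case True
      have "\<exists>s. t_split s (vertical_reflection M)"
      proof (rule t_split_of_diagonal[of _ "int n + int m - 3 - t"])
        fix i j assume a: "i < dim_row (vertical_reflection M)" "j < dim_col (vertical_reflection M)"
        then have ij: "i < n" "j < m" "n - 1 - i < n" by (auto simp: vertical_reflection_def)
        have h: "vertical_reflection M $$ (i, j) = M $$ (n - 1 - i, j)"
          using ij by (simp add: vertical_reflection_def)
        show "vertical_reflection M $$ (i, j) = 1 \<or> vertical_reflection M $$ (i, j) = - 1"
          unfolding h by (rule bin[OF ij(3,2)])
        have e: "int n - 1 - int i = int (n - 1 - i)" "int m - 1 - (int m - 1 - int j) = int j"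
          using ij by auto
        have "flip_cols (int m) P (int n - 1 - int i) (int m - 1 - int j) = (M $$ (n - 1 - i, j) = 1)"
          unfolding flip_cols_def e P ..
        then have "(M $$ (n - 1 - i, j) = 1) = (\<not> int i + int j \<le> int n + int m - 3 - t)"
          using s[of "int n - 1 - int i" "int m - 1 - int j"] ij True by auto
        then show "vertical_reflection M $$ (i, j) = - 1 \<longleftrightarrow> int i + int j \<le> int n + int m - 3 - t"
          unfolding h using bin[OF ij(3,2)] by auto
      qed (use assms(1) in \<open>auto simp: vertical_reflection_def\<close>)
      then show False using assms(5) unfolding split_mat_def by blast
    qed
  next
    case 3
    have "disc M = (\<Sum>i<n. \<Sum>j<m. 2 * of_bool (P (int i) (int j)) - 1)"
      unfolding disc_def dim by (intro sum.cong refl) (use bin P in force)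
    also have "\<dots> = 2 * (\<Sum>i<n. \<Sum>j<m. of_bool (P (int i) (int j))) - int n * int m"
      by (rule sum_double_minus_one)
    also have "(\<Sum>i<n. \<Sum>j<m. of_bool (P (int i) (int j))) = int (card (plus_cells (int n) (int m) P))"
    proof -
      have img: "(\<Sum>i<k. f (int i)) = (\<Sum>i\<in>{0..<int k}. f i)" for k and f :: "int \<Rightarrow> int"
        by (simp add: image_int_atLeastLessThan[of 0 k, symmetric, simplified] sum.reindex
          lessThan_atLeast0)
      show ?thesis unfolding card_plus_cells_sum by (simp add: img[symmetric])
    qed
    finally show False using 3 assms(6) by simp
  qed
qed

end
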